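(* Let $m = p_1 \cdots p_s$ be a positive square-free integer with distinct primes $p_k$, and let $f(x,y) = ax^2+bxy+cy^2$ (with $a,b,c\in\mathbb{Z}$) be a primitive positive definite binary quadratic form of discriminant $D = b^2-4ac = -f_K^2 d$, where $d>0$ is square-free, $f_K$ is a positive integer, and $\gcd(f_K, m) = 1$. Let $K=\mathbb{Q}(\sqrt{-d})$ be the imaginary quadratic field and let $\mathcal{O}\subseteq\mathcal{O}_K$ be the order of discriminant $D$ (of conductor $f_K$). Then $f(x,y)=m$ has a solution $(x,y)\in\mathbb{Z}^2$ if and only if every prime $p_k$ either splits or ramifies in $K$, and, writing $p_1,\dots,p_r$ for the primes that split and $p_{r+1},\dots,p_s$ for the primes that ramify, and choosing for each $k$ a prime $\mathcal{O}$-ideal $\mathfrak{p}_k$ lying above $p_k$ (of norm $p_k$), there exist $\delta_1,\dots,\delta_r\in\{-1,+1\}$ such that \[ \prod_{i=1}^{r}[\mathfrak{p}_i]^{\delta_i}\prod_{j=r+1}^{s}[\mathfrak{p}_j] = [\mathfrak{a}] \] in $\mathrm{Cl}(\mathcal{O})$, where $[\mathfrak{a}]$ is the ideal class in $\mathrm{Cl}(\mathcal{O})$ corresponding to the proper equivalence class $[f]$ in $\mathrm{Cl}(D)$.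
   Context: $\mathrm{Cl}(\mathcal{O})$ is the group of proper invertible fractional $\mathcal{O}$-ideals modulo principal ideals; $\mathrm{Cl}(D)$ is the group (under Dirichlet composition) of primitive positive definite binary quadratic forms of discriminant $D$ modulo proper equivalence ($SL_2(\mathbb{Z})$-action). The correspondence between them is the standard isomorphism $\mathrm{Cl}(\mathcal{O})\to\mathrm{Cl}(D)$ sending an invertible ideal $\mathfrak{a}=\mathbb{Z}\alpha+\mathbb{Z}\beta$ to the class of $N(x\alpha+y\beta)/N(\mathfrak{a})$, with inverse $ax^2+bxy+cy^2\mapsto \mathbb{Z}a+\mathbb{Z}\frac{-b+\sqrt{D}}{2}$. A rational prime $p$ splits in $K$ if $p\mathcal{O}_K$ is a product of two distinct prime ideals, and ramifies if $p\mathcal{O}_K$ is the square of a prime ideal. *)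

theory Defs
  imports
    Complex_Main
    "HOL-Computational_Algebra.Computational_Algebra"
    "HOL-Algebra.Ideal_Product"
    "HOL-Algebra.QuotRing"
    "HOL-Algebra.Subrings"
    "HOL-Algebra.FiniteProduct"
    "HOL-Algebra.Algebraic_Closure_Type"
begin

section \<open>Binary quadratic forms\<close>

text \<open>The triple \<open>(a, b, c)\<close> stands for the form \<open>a x^2 + b x y + c y^2\<close>.\<close>

type_synonym bqf = "int \<times> int \<times> int"

fun bqf_eval :: "bqf \<Rightarrow> int \<Rightarrow> int \<Rightarrow> int" where
  "bqf_eval (a, b, c) x y = a * x^2 + b * x * y + c * y^2"

fun bqf_disc :: "bqf \<Rightarrow> int" where
  "bqf_disc (a, b, c) = b^2 - 4 * a * c"

fun bqf_primitive :: "bqf \<Rightarrow> bool" where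
  "bqf_primitive (a, b, c) \<longleftrightarrow> Gcd {a, b, c} = 1"

definition bqf_pos_def :: "bqf \<Rightarrow> bool" where
  "bqf_pos_def f \<longleftrightarrow> (\<forall>x y. (x, y) \<noteq> (0, 0) \<longrightarrow> bqf_eval f x y > 0)"

definition bqf_forms :: "int \<Rightarrow> bqf set" where
  "bqf_forms D = {f. bqf_primitive f \<and> bqf_pos_def f \<and> bqf_disc f = D}"

definition proper_equiv :: "int \<Rightarrow> (bqf \<times> bqf) set" where
  "proper_equiv D = {(f, g). f \<in> bqf_forms D \<and> g \<in> bqf_forms D \<and>
     (\<exists>p q r s. p * s - q * r = 1 \<and>
        (\<forall>x y. bqf_eval g x y = bqf_eval f (p * x + q * y) (r * x + s * y)))}"

text \<open>The class of \<open>f\<close> as an element of \<open>Cl(D) = bqf_forms D // proper_equiv D\<close>.\<close>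

definition bqf_class :: "bqf \<Rightarrow> bqf set" where
  "bqf_class f = proper_equiv (bqf_disc f) `` {f}"

section \<open>Imaginary quadratic fields and their orders\<close>

text \<open>
  All rings are subrings of the complex numbers: a set \<open>S\<close> of complex numbers closed under
  the ring operations is turned into a ring structure by \<open>as_ring S\<close>. Products of integral
  and of fractional ideals are both sets of finite sums of products, that is,
  \<^const>\<open>ideal_prod\<close> computed in the ambient ring.
\<close>

abbreviation complex_ring :: "complex ring" where
  "complex_ring \<equiv> ring_of_type_algebra"

definition as_ring :: "complex set \<Rightarrow> complex ring" where
  "as_ring S = complex_ring\<lparr>carrier := S\<rparr>"

definition imag_quad_field :: "nat \<Rightarrow> complex set" where
  "imag_quad_field d = {of_rat x + of_rat y * csqrt (- of_nat d) | x y. True}"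

definition ring_of_integers :: "complex set \<Rightarrow> complex set" where
  "ring_of_integers K = {z \<in> K. algebraic_int z}"

definition int_span :: "complex \<Rightarrow> complex \<Rightarrow> complex set" where
  "int_span u v = {of_int x * u + of_int y * v | x y. True}"

definition int_basis :: "complex set \<Rightarrow> complex \<Rightarrow> complex \<Rightarrow> bool" where
  "int_basis L u v \<longleftrightarrow> L = int_span u v \<and>
     (\<forall>x y :: int. of_int x * u + of_int y * v = 0 \<longrightarrow> x = 0 \<and> y = 0)"

definition quadratic_order :: "complex set \<Rightarrow> complex set \<Rightarrow> bool" where
  "quadratic_order K \<O> \<longleftrightarrow>
     subring \<O> complex_ring \<and> \<O> \<subseteq> K \<and> (\<exists>u v. int_basis \<O> u v)"

text \<open>
  The discriminant is the squared determinant of the two embeddings on an integral basis;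
  the nontrivial automorphism of an imaginary quadratic field is complex conjugation.
\<close>

definition order_has_disc :: "complex set \<Rightarrow> int \<Rightarrow> bool" where
  "order_has_disc \<O> D \<longleftrightarrow>
     (\<exists>u v. int_basis \<O> u v \<and> (u * cnj v - cnj u * v)^2 = of_int D)"

section \<open>Primes and ideals\<close>

definition rational_prime_splits :: "complex set \<Rightarrow> nat \<Rightarrow> bool" where
  "rational_prime_splits K q \<longleftrightarrow>
     (let R = as_ring (ring_of_integers K) in
      \<exists>P Q. primeideal P R \<and> primeideal Q R \<and> P \<noteq> Q \<and>
        PIdl\<^bsub>R\<^esub> (of_nat q) = ideal_prod R P Q)"

definition rational_prime_ramifies :: "complex set \<Rightarrow> nat \<Rightarrow> bool" where
  "rational_prime_ramifies K q \<longleftrightarrow>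
     (let R = as_ring (ring_of_integers K) in
      \<exists>P. primeideal P R \<and> PIdl\<^bsub>R\<^esub> (of_nat q) = ideal_prod R P P)"

definition ideal_norm :: "complex set \<Rightarrow> complex set \<Rightarrow> nat" where
  "ideal_norm \<O> I = card (carrier (as_ring \<O> Quot I))"

definition lies_above :: "complex set \<Rightarrow> nat \<Rightarrow> bool" where
  "lies_above P q \<longleftrightarrow> P \<inter> \<int> = {of_int (int q * z) | z. True}"

definition prime_ideal_above :: "complex set \<Rightarrow> nat \<Rightarrow> complex set \<Rightarrow> bool" where
  "prime_ideal_above \<O> q P \<longleftrightarrow>
     primeideal P (as_ring \<O>) \<and> lies_above P q \<and> ideal_norm \<O> P = q"

section \<open>The ideal class group of an order\<close>

definition fractional_ideal :: "complex set \<Rightarrow> complex set \<Rightarrow> complex set \<Rightarrow> bool" where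
  "fractional_ideal K \<O> I \<longleftrightarrow>
     I \<subseteq> K \<and> I \<noteq> {0} \<and> subgroup I (add_monoid complex_ring) \<and>
     (\<forall>r\<in>\<O>. \<forall>x\<in>I. r * x \<in> I) \<and>
     (\<exists>r\<in>\<O>. r \<noteq> 0 \<and> (\<forall>x\<in>I. r * x \<in> \<O>))"

text \<open>
  ``Proper'' means that the ring of multipliers of the ideal is not larger than the order;
  the unit ideal is proper in this sense.
\<close>

definition proper_ideal :: "complex set \<Rightarrow> complex set \<Rightarrow> complex set \<Rightarrow> bool" where
  "proper_ideal K \<O> I \<longleftrightarrow> {z \<in> K. \<forall>x\<in>I. z * x \<in> I} = \<O>"

definition invertible_ideal :: "complex set \<Rightarrow> complex set \<Rightarrow> complex set \<Rightarrow> bool" where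
  "invertible_ideal K \<O> I \<longleftrightarrow>
     (\<exists>J. fractional_ideal K \<O> J \<and> ideal_prod complex_ring I J = \<O>)"

definition ideal_group :: "complex set \<Rightarrow> complex set \<Rightarrow> complex set monoid" where
  "ideal_group K \<O> =
     \<lparr>carrier = {I. fractional_ideal K \<O> I \<and> proper_ideal K \<O> I \<and> invertible_ideal K \<O> I},
      monoid.mult = ideal_prod complex_ring,
      one = \<O>\<rparr>"

definition principal_ideals :: "complex set \<Rightarrow> complex set \<Rightarrow> complex set set" where
  "principal_ideals K \<O> = {(*) z ` \<O> | z. z \<in> K \<and> z \<noteq> 0}"

definition class_group :: "complex set \<Rightarrow> complex set \<Rightarrow> complex set set monoid" where
  "class_group K \<O> = ideal_group K \<O> Mod principal_ideals K \<O>"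

definition ideal_class :: "complex set \<Rightarrow> complex set \<Rightarrow> complex set \<Rightarrow> complex set set" where
  "ideal_class K \<O> I = principal_ideals K \<O> #>\<^bsub>ideal_group K \<O>\<^esub> I"

section \<open>From form classes to ideal classes\<close>

text \<open>
  For negative discriminant, \<^const>\<open>csqrt\<close> picks the square root in the upper half plane.
\<close>

fun bqf_ideal :: "bqf \<Rightarrow> complex set" where
  "bqf_ideal (a, b, c) =
     int_span (of_int a) ((- of_int b + csqrt (of_int (bqf_disc (a, b, c)))) / 2)"

text \<open>
  All forms in a proper equivalence class give the same ideal class, so the set inside
  \<^const>\<open>the_elem\<close> is a singleton when \<open>F\<close> is an element of \<open>Cl(D)\<close> and \<open>\<O>\<close> is the order of
  discriminant \<open>D\<close>.
\<close>

definition ideal_class_of_bqf_class ::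
    "complex set \<Rightarrow> complex set \<Rightarrow> bqf set \<Rightarrow> complex set set" where
  "ideal_class_of_bqf_class K \<O> F = the_elem ((\<lambda>f. ideal_class K \<O> (bqf_ideal f)) ` F)"

end

theory Submission
  imports Defs
begin

text \<open>
  Every ideal in play is a lattice \<open>qlat D n B = \<int> n + \<int> (-B + \<surd>D)/2\<close> with \<open>4 n\<close> dividing \<open>B^2 - D\<close>.
  For coprime norms these multiply by multiplying \<open>n\<close>, and \<open>qlat D n B\<close> times its conjugate
  \<open>qlat D n (-B)\<close> is the principal ideal generated by \<open>n\<close>. The prime ideals of norm \<open>p\<close> above a prime
  \<open>p\<close> not dividing the conductor are the \<open>qlat D p B\<close>, where \<open>B\<close> is unique modulo \<open>2 p\<close> up to
  sign; so replacing a prime by its inverse class is changing the sign of \<open>B\<close>.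

  If \<open>f\<close> represents the square-free number \<open>m\<close>, it does so primitively, hence \<open>f\<close> is properly equivalent
  to some \<open>m x^2 + B x y + C y^2\<close>, and its class is that of \<open>qlat D m B\<close>, the product of the
  \<open>qlat D p B\<close> over the primes \<open>p\<close> dividing \<open>m\<close>. Conversely, the Chinese remainder theorem turns a
  product of classes of \<open>qlat D p (\<plusminus>\<beta>)\<close> into the class of one \<open>qlat D m B\<close>; if this lattice
  is homothetic to the ideal of \<open>f\<close>, comparing norms shows that the image of \<open>m\<close> is an element on
  which \<open>f\<close> takes the value \<open>m\<close>.
\<close>

section \<open>Products of lattices\<close>

text \<open>Splitting and ramification concern ideals of the maximal order, whereas the classes live
  in the order of discriminant \<open>D\<close>. Ideals of the two rings are never compared
  directly; the link is the congruence \<beta>^2 = D modulo 4 q. For a prime q not dividing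
  \<open>g\<close> its solvability decides whether q splits or ramifies, and scaling \<beta> carries
  solutions from one discriminant to the other. Coprimality with \<open>g\<close> also makes the
  lattices invertible: a common prime factor of n, B and (B^2 - D)/(4 n) would have its square
  dividing D, hence dividing the square-free number d. Split and ramified primes differ in the
  effect of the sign of \<beta>. The moduli are 2 n rather than n because B always has the parity of
  D, so that only (B - D)/2 is free.\<close>

definition lat_prod :: "complex set \<Rightarrow> complex set \<Rightarrow> complex set" where
  "lat_prod = ideal_prod complex_ring"

lemma complex_ring_simps [simp]:
  "carrier complex_ring = UNIV" "x \<otimes>\<^bsub>complex_ring\<^esub> y = x * y" "\<one>\<^bsub>complex_ring\<^esub> = 1"
  "\<zero>\<^bsub>complex_ring\<^esub> = 0" "x \<oplus>\<^bsub>complex_ring\<^esub> y = x + y"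
  by (simp_all add: ring_of_type_algebra_def)

lemma complex_cring: "cring complex_ring"
  by (rule cring_from_type_algebra)

lemma complex_ring_a_inv [simp]: "\<ominus>\<^bsub>complex_ring\<^esub> x = - x"
proof -
  interpret cring complex_ring by (rule complex_cring)
  show ?thesis using minus_equality[of "-x" x] by simp
qed

section \<open>Additive subgroups of the complex numbers, and spans of two elements\<close>

definition add_subgrp :: "complex set \<Rightarrow> bool" where
  "add_subgrp I \<longleftrightarrow> 0 \<in> I \<and> (\<forall>x\<in>I. \<forall>y\<in>I. x + y \<in> I) \<and> (\<forall>x\<in>I. - x \<in> I)"

lemma subgroup_complex_iff: "subgroup I (add_monoid complex_ring) \<longleftrightarrow> add_subgrp I"
proof -
  have "inv\<^bsub>add_monoid complex_ring\<^esub> x = - x" for x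
    using complex_ring_a_inv[of x] by (simp add: a_inv_def)
  then show ?thesis
    by (auto simp: subgroup_def add_subgrp_def)
qed

lemma add_subgrpD:
  assumes "add_subgrp I"
  shows "0 \<in> I" "x \<in> I \<Longrightarrow> y \<in> I \<Longrightarrow> x + y \<in> I" "x \<in> I \<Longrightarrow> - x \<in> I" "x \<in> I \<Longrightarrow> y \<in> I \<Longrightarrow> x - y \<in> I"
proof -
  show "0 \<in> I" "x \<in> I \<Longrightarrow> y \<in> I \<Longrightarrow> x + y \<in> I" "x \<in> I \<Longrightarrow> - x \<in> I"
    using assms by (auto simp: add_subgrp_def)
  show "x - y \<in> I" if "x \<in> I" "y \<in> I"
    using assms that by (metis add_subgrp_def diff_conv_add_uminus)
qed

lemma add_subgrp_of_nat_mult: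
  assumes "add_subgrp I" "x \<in> I" shows "of_nat n * x \<in> I"
  by (induction n) (use assms in \<open>auto simp: distrib_right intro: add_subgrpD\<close>)

lemma add_subgrp_of_int_mult:
  assumes "add_subgrp I" "x \<in> I" shows "of_int n * x \<in> I"
proof (cases n)
  case (nonneg k) then show ?thesis using add_subgrp_of_nat_mult[OF assms] by simp
next
  case (neg k)
  have "of_int n * x = - (of_nat (Suc k) * x)" unfolding neg by (simp only: of_int_minus of_int_of_nat_eq minus_mult_left)
  then show ?thesis using add_subgrpD(3)[OF assms(1) add_subgrp_of_nat_mult[OF assms, of "Suc k"]]
    by simp
qed

lemma add_subgrp_int_span [simp]: "add_subgrp (int_span u v)"
  unfolding add_subgrp_def
proof (intro conjI ballI)
  show "0 \<in> int_span u v" unfolding int_span_def by (auto intro!: exI[of _ 0])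
next
  fix x y assume "x \<in> int_span u v" "y \<in> int_span u v"
  then obtain a b a' b' :: int where "x = of_int a * u + of_int b * v" "y = of_int a' * u + of_int b' * v"
    by (auto simp: int_span_def)
  then have "x + y = of_int (a + a') * u + of_int (b + b') * v" by (simp add: algebra_simps)
  then show "x + y \<in> int_span u v" unfolding int_span_def by blast
next
  fix x assume "x \<in> int_span u v"
  then obtain a b :: int where "x = of_int a * u + of_int b * v" 
    by (auto simp: int_span_def)
  then have "- x = of_int (- a) * u + of_int (- b) * v" by (simp add: algebra_simps)
  then show "- x \<in> int_span u v" unfolding int_span_def by blast
qed

lemma int_spanI: "z = of_int x * u + of_int y * v \<Longrightarrow> z \<in> int_span u v"
  unfolding int_span_def by blast

lemma int_spanE:
  assumes "z \<in> int_span u v"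
  obtains x y :: int where "z = of_int x * u + of_int y * v"
  using assms unfolding int_span_def by blast

lemma int_span_subset:
  assumes "add_subgrp I" "u \<in> I" "v \<in> I" shows "int_span u v \<subseteq> I"
  using assms by (auto elim!: int_spanE intro!: add_subgrpD(2) add_subgrp_of_int_mult)

lemma int_span_gens [simp]: "u \<in> int_span u v" "v \<in> int_span u v"
  by (simp add: int_spanI[of _ 1 _ 0], simp add: int_spanI[of _ 0 _ 1])

lemma int_span_scale: "(*) z ` int_span u v = int_span (z * u) (z * v)"
proof -
  have "z * (of_int x * u + of_int y * v) = of_int x * (z * u) + of_int y * (z * v)" for x y
    by (simp add: algebra_simps)
  then show ?thesis unfolding int_span_def by (auto simp: image_iff) metis+
qed

lemma lat_prod_mult: "x \<in> I \<Longrightarrow> y \<in> J \<Longrightarrow> x * y \<in> lat_prod I J"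
  unfolding lat_prod_def using ideal_prod.prod[of x I y J complex_ring] by simp

lemma lat_prod_add: "x \<in> lat_prod I J \<Longrightarrow> y \<in> lat_prod I J \<Longrightarrow> x + y \<in> lat_prod I J"
  unfolding lat_prod_def using ideal_prod.sum[of x complex_ring I J y] by simp

lemma lat_prod_induct [consumes 1, case_names mult add]:
  assumes "z \<in> lat_prod I J"
    and "\<And>x y. x \<in> I \<Longrightarrow> y \<in> J \<Longrightarrow> P (x * y)"
    and "\<And>x y. P x \<Longrightarrow> P y \<Longrightarrow> P (x + y)"
  shows "P z"
  using assms(1) unfolding lat_prod_def by (induction rule: ideal_prod.induct) (auto intro: assms(2,3))

lemma lat_prod_least:
  assumes "\<And>x y. x \<in> I \<Longrightarrow> y \<in> J \<Longrightarrow> x * y \<in> S"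
    and "\<And>x y. x \<in> S \<Longrightarrow> y \<in> S \<Longrightarrow> x + y \<in> S"
  shows "lat_prod I J \<subseteq> S"
proof
  fix z assume "z \<in> lat_prod I J" then show "z \<in> S"
    by (induction rule: lat_prod_induct) (use assms in auto)
qed

lemma lat_prod_mono: "I \<subseteq> I' \<Longrightarrow> J \<subseteq> J' \<Longrightarrow> lat_prod I J \<subseteq> lat_prod I' J'"
  by (rule lat_prod_least) (auto intro: lat_prod_mult lat_prod_add)

lemma lat_prod_comm: "lat_prod I J = lat_prod J I"
proof -
  have "lat_prod I J \<subseteq> lat_prod J I" for I J
    by (rule lat_prod_least) (auto intro: lat_prod_add, metis lat_prod_mult mult.commute)
  then show ?thesis by blast
qed

lemma lat_prod_assoc: "lat_prod (lat_prod I J) L = lat_prod I (lat_prod J L)"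
proof -
  have sub: "lat_prod (lat_prod I J) L \<subseteq> lat_prod I (lat_prod J L)" for I J L
  proof (rule lat_prod_least)
    fix x y assume "x \<in> lat_prod I J" "y \<in> L"
    then show "x * y \<in> lat_prod I (lat_prod J L)"
      by (induction rule: lat_prod_induct)
        (auto simp: mult.assoc distrib_right intro!: lat_prod_mult lat_prod_add)
  qed (auto intro: lat_prod_add)
  \<comment> \<open>The reverse inclusion is \<open>sub\<close> for the triple L, J, I, read through
    commutativity.\<close>
  have "lat_prod I (lat_prod J L) = lat_prod (lat_prod L J) I"
    by (metis lat_prod_comm)
  also have "\<dots> \<subseteq> lat_prod L (lat_prod J I)" by (rule sub)
  also have "\<dots> = lat_prod (lat_prod I J) L" by (metis lat_prod_comm)
  finally show ?thesis using sub[of I J L] by blast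
qed

lemma add_subgrp_lat_prod:
  assumes "add_subgrp I" "add_subgrp J" shows "add_subgrp (lat_prod I J)"
  unfolding add_subgrp_def
proof (intro conjI ballI)
  show "0 \<in> lat_prod I J" using lat_prod_mult[of 0 I 0 J] assms by (simp add: add_subgrp_def)
next
  fix x assume "x \<in> lat_prod I J" then show "- x \<in> lat_prod I J"
  proof (induction rule: lat_prod_induct)
    case (mult x y) then show ?case using lat_prod_mult[of "- x" I y J] assms by (simp add: add_subgrp_def)
  next
    case (add x y) then show ?case using lat_prod_add[of "- x" I J "- y"] by simp
  qed
qed (rule lat_prod_add)

lemma lat_prod_scale: "lat_prod ((*) z ` I) J = (*) z ` lat_prod I J"
proof
  show "lat_prod ((*) z ` I) J \<subseteq> (*) z ` lat_prod I J"
    by (rule lat_prod_least)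
      (auto simp: mult.assoc intro!: imageI lat_prod_mult, metis distrib_left imageI lat_prod_add)
  have "z * x \<in> lat_prod ((*) z ` I) J" if "x \<in> lat_prod I J" for x
    using that
    by (induction rule: lat_prod_induct)
      (auto simp: distrib_left mult.assoc[symmetric] intro!: lat_prod_mult lat_prod_add)
  then show "(*) z ` lat_prod I J \<subseteq> lat_prod ((*) z ` I) J" by auto
qed

lemma lat_prod_unit:
  assumes "add_subgrp I" "1 \<in> R" "\<And>r x. r \<in> R \<Longrightarrow> x \<in> I \<Longrightarrow> r * x \<in> I"
  shows "lat_prod R I = I"
proof
  show "lat_prod R I \<subseteq> I" by (rule lat_prod_least) (use assms in \<open>auto simp: add_subgrp_def\<close>)
  show "I \<subseteq> lat_prod R I" using lat_prod_mult[of 1 R _ I] assms(2) by auto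
qed

section \<open>The class group\<close>

text \<open>\<open>denominator\<close> makes \<open>K\<close> the field of fractions of
  \<open>\<O>\<close>, so that multiples of a fractional ideal by nonzero elements of
  \<open>K\<close> are again fractional. \<open>field_inverse\<close> can include zero because
  \<open>inverse 0 = 0\<close>.\<close>

locale order_in_field =
  fixes K \<O> :: "complex set"
  assumes order_subgrp: "add_subgrp \<O>" and order_one: "1 \<in> \<O>"
    and order_mult: "x \<in> \<O> \<Longrightarrow> y \<in> \<O> \<Longrightarrow> x * y \<in> \<O>"
    and order_subset: "\<O> \<subseteq> K"
    and field_add: "x \<in> K \<Longrightarrow> y \<in> K \<Longrightarrow> x + y \<in> K"
    and field_mult: "x \<in> K \<Longrightarrow> y \<in> K \<Longrightarrow> x * y \<in> K"
    and field_inverse: "x \<in> K \<Longrightarrow> inverse x \<in> K"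
    and denominator: "x \<in> K \<Longrightarrow> \<exists>r\<in>\<O>. r \<noteq> 0 \<and> r * x \<in> \<O>"
begin

lemma fractional_ideal_iff:
  "fractional_ideal K \<O> I \<longleftrightarrow> I \<subseteq> K \<and> (\<exists>x\<in>I. x \<noteq> 0) \<and> add_subgrp I \<and>
     (\<forall>r\<in>\<O>. \<forall>x\<in>I. r * x \<in> I) \<and> (\<exists>r\<in>\<O>. r \<noteq> 0 \<and> (\<forall>x\<in>I. r * x \<in> \<O>))"
  unfolding fractional_ideal_def subgroup_complex_iff by (auto simp: add_subgrp_def)

lemma lat_prod_order:
  assumes "fractional_ideal K \<O> I" shows "lat_prod \<O> I = I"
  by (rule lat_prod_unit) (use assms order_one in \<open>auto simp: fractional_ideal_iff\<close>)

lemma fractional_ideal_lat_prod: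
  assumes I: "fractional_ideal K \<O> I" and J: "fractional_ideal K \<O> J"
  shows "fractional_ideal K \<O> (lat_prod I J)"
proof -
  have "lat_prod I J \<subseteq> K"
    by (rule lat_prod_least) (use I J in \<open>auto simp: fractional_ideal_iff intro!: field_add field_mult\<close>)
  moreover obtain x y where "x \<in> I" "x \<noteq> 0" "y \<in> J" "y \<noteq> 0"
    using I J by (auto simp: fractional_ideal_iff)
  then have "\<exists>z\<in>lat_prod I J. z \<noteq> 0" by (intro bexI[of _ "x * y"] lat_prod_mult) auto
  moreover have "r * x \<in> lat_prod I J" if "r \<in> \<O>" "x \<in> lat_prod I J" for r x
    using that(2)
  proof (induction rule: lat_prod_induct)
    case (mult x y)
    then show ?case using I that(1) lat_prod_mult[of "r * x" I y J]
      by (simp add: fractional_ideal_iff mult.assoc)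
  qed (simp add: distrib_left lat_prod_add)
  moreover obtain r r' where r: "r \<in> \<O>" "r \<noteq> 0" "\<forall>x\<in>I. r * x \<in> \<O>" "r' \<in> \<O>" "r' \<noteq> 0" "\<forall>x\<in>J. r' * x \<in> \<O>"
    using I J by (auto simp: fractional_ideal_iff)
  have "r * r' * x \<in> \<O>" if "x \<in> lat_prod I J" for x
    using that
  proof (induction rule: lat_prod_induct)
    case (mult x y)
    then show ?case using order_mult[of "r * x" "r' * y"] r by (simp add: ac_simps)
  qed (simp add: distrib_left add_subgrpD[OF order_subgrp])
  then have "\<exists>r\<in>\<O>. r \<noteq> 0 \<and> (\<forall>x\<in>lat_prod I J. r * x \<in> \<O>)"
    using r order_mult by (intro bexI[of _ "r * r'"]) auto
  ultimately show ?thesis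
    using I J by (simp add: fractional_ideal_iff add_subgrp_lat_prod)
qed

lemma fractional_ideal_order: "fractional_ideal K \<O> \<O>"
  unfolding fractional_ideal_iff
  using order_subset order_one order_subgrp order_mult by (auto intro!: bexI[of _ 1])

text \<open>Multiplying z I \<subseteq> I by the inverse J gives z \<O> \<subseteq> \<O>, and then z
  = z 1 lies in \<O>.\<close>

lemma proper_ideal_of_inverse:
  assumes I: "fractional_ideal K \<O> I" and inv: "lat_prod I J = \<O>"
  shows "proper_ideal K \<O> I"
  unfolding proper_ideal_def
proof (intro equalityI subsetI)
  fix z assume z: "z \<in> {z \<in> K. \<forall>x\<in>I. z * x \<in> I}"
  then have "lat_prod ((*) z ` I) J \<subseteq> lat_prod I J" by (intro lat_prod_mono) auto
  then have "(*) z ` \<O> \<subseteq> \<O>" by (simp add: lat_prod_scale inv)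
  then show "z \<in> \<O>" using order_one by force
qed (use I order_subset in \<open>auto simp: fractional_ideal_iff\<close>)

lemma carrier_ideal_group:
  "I \<in> carrier (ideal_group K \<O>) \<longleftrightarrow>
     fractional_ideal K \<O> I \<and> (\<exists>J. fractional_ideal K \<O> J \<and> lat_prod I J = \<O>)"
  unfolding ideal_group_def invertible_ideal_def lat_prod_def[symmetric]
  using proper_ideal_of_inverse by (simp, blast)

lemma mult_ideal_group [simp]: "I \<otimes>\<^bsub>ideal_group K \<O>\<^esub> J = lat_prod I J"
  by (simp add: ideal_group_def lat_prod_def)

lemma one_ideal_group [simp]: "\<one>\<^bsub>ideal_group K \<O>\<^esub> = \<O>"
  by (simp add: ideal_group_def)

lemma comm_group_ideal_group: "comm_group (ideal_group K \<O>)"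
proof (rule comm_groupI)
  fix I J assume "I \<in> carrier (ideal_group K \<O>)" "J \<in> carrier (ideal_group K \<O>)"
  then obtain I' J' where *: "fractional_ideal K \<O> I" "fractional_ideal K \<O> J"
    "fractional_ideal K \<O> I'" "fractional_ideal K \<O> J'" "lat_prod I I' = \<O>" "lat_prod J J' = \<O>"
    by (auto simp: carrier_ideal_group)
  have "lat_prod (lat_prod I J) (lat_prod I' J') = lat_prod (lat_prod I I') (lat_prod J J')"
    by (metis lat_prod_assoc lat_prod_comm)
  also have "\<dots> = \<O>" using * fractional_ideal_order by (simp add: lat_prod_order)
  finally show "I \<otimes>\<^bsub>ideal_group K \<O>\<^esub> J \<in> carrier (ideal_group K \<O>)"
    using fractional_ideal_lat_prod *(1-4) unfolding carrier_ideal_group mult_ideal_group by blast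
next
  fix I assume I: "I \<in> carrier (ideal_group K \<O>)"
  then obtain J where J: "fractional_ideal K \<O> J" "lat_prod I J = \<O>" "fractional_ideal K \<O> I"
    unfolding carrier_ideal_group by blast
  then have "lat_prod J I = \<O>" by (metis lat_prod_comm)
  then show "\<exists>J\<in>carrier (ideal_group K \<O>). J \<otimes>\<^bsub>ideal_group K \<O>\<^esub> I = \<one>\<^bsub>ideal_group K \<O>\<^esub>"
    using J unfolding mult_ideal_group one_ideal_group
    by (intro bexI[of _ J]) (auto simp only: carrier_ideal_group)
  show "\<one>\<^bsub>ideal_group K \<O>\<^esub> \<otimes>\<^bsub>ideal_group K \<O>\<^esub> I = I"
    using I by (simp add: carrier_ideal_group lat_prod_order)
next
  show "\<one>\<^bsub>ideal_group K \<O>\<^esub> \<in> carrier (ideal_group K \<O>)"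
    unfolding carrier_ideal_group one_ideal_group
    using fractional_ideal_order lat_prod_order[OF fractional_ideal_order] by blast
qed (simp_all add: lat_prod_assoc, rule lat_prod_comm)

section \<open>Principal ideals and the quotient by them\<close>

lemma fractional_ideal_scale:
  assumes I: "fractional_ideal K \<O> I" and z: "z \<in> K" "z \<noteq> 0"
  shows "fractional_ideal K \<O> ((*) z ` I)"
proof -
  obtain r r' where r: "r \<in> \<O>" "r \<noteq> 0" "\<forall>x\<in>I. r * x \<in> \<O>" "r' \<in> \<O>" "r' \<noteq> 0" "r' * z \<in> \<O>"
    using I z denominator[of z] by (auto simp: fractional_ideal_iff)
  have "r * r' * (z * x) \<in> \<O>" if "x \<in> I" for x
    using order_mult[of "r * x" "r' * z"] r that by (simp add: ac_simps)
  then have "\<exists>r\<in>\<O>. r \<noteq> 0 \<and> (\<forall>x\<in>(*) z ` I. r * x \<in> \<O>)"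
    using r order_mult by (intro bexI[of _ "r * r'"]) auto
  moreover have "add_subgrp ((*) z ` I)"
  proof -
    have "z * x + z * y \<in> (*) z ` I" "- (z * x) \<in> (*) z ` I" if "x \<in> I" "y \<in> I" for x y
      using that I
      by (auto simp: distrib_left[symmetric] mult_minus_right[symmetric] add_subgrp_def fractional_ideal_iff
          simp del: mult_minus_right)
    then show ?thesis using I by (auto simp: add_subgrp_def fractional_ideal_iff)
  qed
  moreover have "r * (z * x) \<in> (*) z ` I" if "r \<in> \<O>" "x \<in> I" for r x
    using I that by (auto simp: fractional_ideal_iff mult.left_commute)
  ultimately show ?thesis
    using I z by (auto simp: fractional_ideal_iff intro!: field_mult)
qed

lemma lat_prod_scale_right: "lat_prod I ((*) z ` J) = (*) z ` lat_prod I J"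
  by (metis lat_prod_comm lat_prod_scale)

lemma scale_scale: "(*) z ` (*) w ` I = (*) (z * w) ` (I :: complex set)"
  by (simp add: image_image mult.assoc)

lemma lat_prod_principal:
  "lat_prod ((*) z ` \<O>) ((*) w ` \<O>) = (*) (z * w) ` \<O>"
  by (simp add: lat_prod_scale lat_prod_scale_right scale_scale lat_prod_order fractional_ideal_order
      mult.commute[of z w])

lemma principal_in_ideal_group:
  assumes "z \<in> K" "z \<noteq> 0" shows "(*) z ` \<O> \<in> carrier (ideal_group K \<O>)"
proof -
  have "lat_prod ((*) z ` \<O>) ((*) (inverse z) ` \<O>) = \<O>"
    using assms by (simp add: lat_prod_principal)
  moreover have "fractional_ideal K \<O> ((*) (inverse z) ` \<O>)"
    by (rule fractional_ideal_scale) (use assms fractional_ideal_order in \<open>auto intro: field_inverse\<close>)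
  ultimately show ?thesis using fractional_ideal_scale[OF fractional_ideal_order assms]
    unfolding carrier_ideal_group by blast
qed

lemma subgroup_principal_ideals: "subgroup (principal_ideals K \<O>) (ideal_group K \<O>)"
proof -
  interpret comm_group "ideal_group K \<O>" by (rule comm_group_ideal_group)
  show ?thesis
  proof (rule subgroupI)
    show "principal_ideals K \<O> \<subseteq> carrier (ideal_group K \<O>)"
      using principal_in_ideal_group unfolding principal_ideals_def by blast
    show "principal_ideals K \<O> \<noteq> {}"
      using order_one order_subset one_neq_zero unfolding principal_ideals_def by blast
  next
    fix I assume "I \<in> principal_ideals K \<O>"
    then obtain z where z: "I = (*) z ` \<O>" "z \<in> K" "z \<noteq> 0"
      unfolding principal_ideals_def by blast
    have "inv\<^bsub>ideal_group K \<O>\<^esub> I = (*) (inverse z) ` \<O>"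
      using z by (intro inv_equality) (auto simp: lat_prod_principal intro!: principal_in_ideal_group field_inverse)
    then show "inv\<^bsub>ideal_group K \<O>\<^esub> I \<in> principal_ideals K \<O>"
      unfolding principal_ideals_def using z field_inverse[of z] nonzero_imp_inverse_nonzero[of z] by blast
  next
    fix I J assume "I \<in> principal_ideals K \<O>" "J \<in> principal_ideals K \<O>"
    then obtain z w where "I = (*) z ` \<O>" "z \<in> K" "z \<noteq> 0" "J = (*) w ` \<O>" "w \<in> K" "w \<noteq> 0"
      unfolding principal_ideals_def by blast
    then show "I \<otimes>\<^bsub>ideal_group K \<O>\<^esub> J \<in> principal_ideals K \<O>"
      unfolding principal_ideals_def mult_ideal_group using lat_prod_principal field_mult[of z w]
      by (intro CollectI exI[of _ "z * w"]) simp
  qed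
qed

lemma comm_group_class_group: "comm_group (class_group K \<O>)"
  unfolding class_group_def
  by (rule comm_group.abelian_FactGroup[OF comm_group_ideal_group subgroup_principal_ideals])

lemma normal_principal_ideals: "principal_ideals K \<O> \<lhd> ideal_group K \<O>"
  using comm_group.normal_iff_subgroup[OF comm_group_ideal_group] subgroup_principal_ideals by simp

lemma ideal_class_closed:
  "I \<in> carrier (ideal_group K \<O>) \<Longrightarrow> ideal_class K \<O> I \<in> carrier (class_group K \<O>)"
  by (simp add: ideal_class_def class_group_def carrier_FactGroup)

lemma ideal_class_mult:
  assumes "I \<in> carrier (ideal_group K \<O>)" "J \<in> carrier (ideal_group K \<O>)"
  shows "ideal_class K \<O> (lat_prod I J) = ideal_class K \<O> I \<otimes>\<^bsub>class_group K \<O>\<^esub> ideal_class K \<O> J"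
  using hom_mult[OF normal.r_coset_hom_Mod[OF normal_principal_ideals] assms]
  by (simp add: ideal_class_def class_group_def)

lemma ideal_class_one: "ideal_class K \<O> \<O> = \<one>\<^bsub>class_group K \<O>\<^esub>"
proof -
  interpret comm_group "ideal_group K \<O>" by (rule comm_group_ideal_group)
  show ?thesis
    using coset_join2[OF one_closed subgroup_principal_ideals subgroup.one_closed[OF subgroup_principal_ideals]]
    by (simp add: ideal_class_def class_group_def FactGroup_def)
qed

text \<open>Since (z \<O>) J = z J, the coset of J consists of its nonzero multiples. Equality of
  classes thus becomes homothety of lattices, the form in which it is used from here on.\<close>

lemma ideal_class_eq_iff:
  assumes I: "I \<in> carrier (ideal_group K \<O>)" and J: "J \<in> carrier (ideal_group K \<O>)"
  shows "ideal_class K \<O> I = ideal_class K \<O> J \<longleftrightarrow> (\<exists>z\<in>K. z \<noteq> 0 \<and> I = (*) z ` J)"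
proof -
  interpret comm_group "ideal_group K \<O>" by (rule comm_group_ideal_group)
  have coset: "ideal_class K \<O> J = {(*) z ` J | z. z \<in> K \<and> z \<noteq> 0}"
  proof -
    have "lat_prod ((*) z ` \<O>) J = (*) z ` J" for z
      using J by (simp add: lat_prod_scale lat_prod_order carrier_ideal_group)
    then show ?thesis by (auto simp: ideal_class_def r_coset_def principal_ideals_def)
  qed
  have "I \<in> ideal_class K \<O> I"
    using rcos_self[OF I subgroup_principal_ideals] by (simp add: ideal_class_def)
  moreover have "ideal_class K \<O> J = ideal_class K \<O> I" if "I \<in> ideal_class K \<O> J"
    using repr_independence[OF _ J subgroup_principal_ideals] that by (simp add: ideal_class_def)
  ultimately have "ideal_class K \<O> I = ideal_class K \<O> J \<longleftrightarrow> I \<in> ideal_class K \<O> J" by auto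
  then show ?thesis unfolding coset by auto
qed

end

section \<open>The quadratic order of a given discriminant\<close>

text \<open>For D = b^2 - 4 a c the lattice \<open>qlat D a b\<close> is
  \<open>bqf_ideal (a, b, c)\<close>. The discriminant is an argument because the order at hand and
  the maximal order both occur.\<close>

definition qlat :: "int \<Rightarrow> int \<Rightarrow> int \<Rightarrow> complex set" where
  "qlat D n B = int_span (of_int n) ((- of_int B + csqrt (of_int D)) / 2)"

lemma add_subgrp_qlat [simp]: "add_subgrp (qlat D n B)"
  by (simp add: qlat_def)

lemma csqrt_neg_real: "r \<ge> 0 \<Longrightarrow> csqrt (- of_real r) = \<i> * of_real (sqrt r)"
  by (simp add: csqrt_of_real_nonpos)

text \<open>\<open>disc_cong\<close> says that D is 0 or 1 modulo 4, written as the condition 4 n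
  dvd B^2 - D for n = 1 and B = D; it makes \<open>qlat D 1 D\<close> a ring. The number
  \<open>g\<close> is the conductor if d is 3 modulo 4, and twice the conductor otherwise.\<close>

locale quad_order =
  fixes d g :: nat and D :: int
  assumes d_pos: "d > 0" and g_pos: "g > 0" and D_eq: "D = - ((int g)\<^sup>2 * int d)"
    and sqf: "squarefree d" and disc_cong: "4 dvd D * D - D"
begin

abbreviation "K \<equiv> imag_quad_field d"
abbreviation "\<O> \<equiv> qlat D 1 D"
definition rt :: complex where "rt = csqrt (of_int D)"

lemma qlat_eq: "qlat D n B = int_span (of_int n) ((- of_int B + rt) / 2)"
  by (simp add: qlat_def rt_def)

lemma D_neg: "D < 0" using d_pos g_pos by (simp add: D_eq)

lemma rt_eq: "rt = \<i> * of_real (sqrt (- of_int D))"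
  unfolding rt_def using csqrt_neg_real[of "- of_int D"] D_neg by simp

lemma Re_rt [simp]: "Re rt = 0" and Im_rt_pos: "Im rt > 0" and cnj_rt [simp]: "cnj rt = - rt"
  and rt_sq: "rt * rt = of_int D"
  using D_neg by (simp_all add: rt_eq complex_eq_iff)

lemma lin_indep:
  assumes "of_real x + of_real y * rt = 0" shows "x = 0" "y = 0"
proof -
  have "Im (of_real x + of_real y * rt) = y * Im rt" "Re (of_real x + of_real y * rt) = x" by simp_all
  then show "x = 0" "y = 0" using assms Im_rt_pos by auto
qed

lemma rt_field: "rt = of_nat g * csqrt (- of_nat d)"
proof -
  have "csqrt (- of_nat d) = \<i> * of_real (sqrt (of_nat d))"
    using csqrt_neg_real[of "of_nat d"] by simp
  moreover have "- real_of_int D = (real g)\<^sup>2 * real d" by (simp add: D_eq)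
  ultimately show ?thesis
    unfolding rt_eq by (simp only: real_sqrt_mult real_sqrt_abs) simp
qed

lemma mem_K_iff: "z \<in> K \<longleftrightarrow> (\<exists>x y :: rat. z = of_rat x + of_rat y * rt)"
proof
  assume "z \<in> K"
  then obtain x y where "z = of_rat x + of_rat y * csqrt (- of_nat d)" by (auto simp: imag_quad_field_def)
  then have "z = of_rat x + of_rat (y / of_nat g) * rt"
    using g_pos by (simp add: rt_field of_rat_divide)
  then show "\<exists>x y :: rat. z = of_rat x + of_rat y * rt" by blast
next
  assume "\<exists>x y :: rat. z = of_rat x + of_rat y * rt"
  then obtain x y where "z = of_rat x + of_rat y * rt" by blast
  then have "z = of_rat x + of_rat (y * of_nat g) * csqrt (- of_nat d)"
    by (simp add: rt_field of_rat_mult)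
  then show "z \<in> K" unfolding imag_quad_field_def by blast
qed

lemma mem_qlat_iff:
  "z \<in> qlat D n B \<longleftrightarrow> (\<exists>x y. z = of_int x * of_int n + of_int y * ((- of_int B + rt) / 2))"
  by (auto simp: qlat_eq int_span_def)

text \<open>The generator is a root of X^2 + B X + k, a polynomial of discriminant B^2 - 4 k =
  D.\<close>

lemma gen_sq:
  assumes "B * B - D = 4 * k"
  shows "((- of_int B + rt) / 2) * ((- of_int B + rt) / 2) = - of_int B * ((- of_int B + rt) / 2) - of_int k"
proof -
  have "D = B * B - 4 * k" using assms by simp
  then have k: "of_int D = of_int B * of_int B - 4 * (of_int k :: complex)" by simp
  define b where "b = (- of_int B + rt) / 2"
  have "4 * (b * b + of_int B * b + of_int k) = rt * rt - of_int D"
    unfolding b_def k by (simp add: field_simps)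
  then have "b * b + of_int B * b + of_int k = 0"
    using rt_sq by (metis diff_self mult_eq_0_iff zero_neq_numeral)
  then have "b * b = - of_int B * b - of_int k" by (simp add: eq_neg_iff_add_eq_0 algebra_simps)
  then show ?thesis unfolding b_def .
qed

text \<open>The second factor is minus the conjugate of the first, so the product is minus the norm
  k. It is at the same time the second generator for -B.\<close>

lemma gen_norm:
  assumes "B * B - D = 4 * k"
  shows "((- of_int B + rt) / 2) * ((of_int B + rt) / 2) = - of_int k"
proof -
  have "D = B * B - 4 * k" using assms by simp
  then have k: "of_int D = of_int B * of_int B - 4 * (of_int k :: complex)" by simp
  show ?thesis using rt_sq unfolding k by (simp add: field_simps)
qed

lemma order_element_norm:
  assumes "D * D - D = 4 * k" and z: "z = of_int x * of_int 1 + of_int y * ((- of_int D + rt) / 2)"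
  shows "z * cnj z = of_int (x * x - x * y * D + y * y * k)"
proof -
  have "z * cnj z = of_int (x * x) + of_int (x * y) * ((- of_int D + rt) / 2 + (- of_int D - rt) / 2)
      - of_int (y * y) * (((- of_int D + rt) / 2) * ((of_int D + rt) / 2))"
    unfolding z by (simp add: field_simps)
  also have "\<dots> = of_int (x * x - x * y * D + y * y * k)"
    unfolding gen_norm[OF assms(1)] by (simp add: field_simps)
  finally show ?thesis .
qed

text \<open>A change of B by a multiple of 2 n shifts the second generator by a multiple of the
  first.\<close>

lemma qlat_cong_subset:
  assumes "2 * n dvd B - B'" shows "qlat D n B \<subseteq> qlat D n B'"
proof -
  obtain k where k: "B - B' = 2 * n * k" using assms by blast
  then have "B = B' + 2 * n * k" by simp
  then have "(- of_int B + rt) / 2 = of_int (- k) * of_int n + of_int 1 * ((- of_int B' + rt) / 2)"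
    by (simp add: field_simps)
  then have "(- of_int B + rt) / 2 \<in> qlat D n B'" unfolding mem_qlat_iff by blast
  then show ?thesis unfolding qlat_eq[of n B]
    by (intro int_span_subset) (auto simp: qlat_eq)
qed

lemma qlat_cong:
  assumes "2 * n dvd B - B'" shows "qlat D n B = qlat D n B'"
  using qlat_cong_subset[of n B B'] qlat_cong_subset[of n B' B] assms
  by (metis dvd_minus_iff minus_diff_eq subset_antisym)

lemma disc_parity: "4 dvd B * B - D \<Longrightarrow> even (B - D)"
  using dvd_trans[of 2 4 "B * B - D"] by simp

text \<open>B has the parity of D, so the order can be written with the same second generator as
  whichever ideal is being studied.\<close>

lemma order_eq_qlat:
  assumes "4 dvd B * B - D" shows "\<O> = qlat D 1 B"
  using disc_parity[OF assms] by (intro qlat_cong) auto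

lemma int_mem_qlat:
  assumes "of_int k \<in> qlat D n B" shows "n dvd k"
proof -
  obtain x y where "of_int k = of_int x * of_int n + of_int y * ((- of_int B + rt) / 2)"
    using assms unfolding mem_qlat_iff by blast
  then have "of_real (of_int x * of_int n - of_int y * of_int B / 2 - of_int k) + of_real (of_int y / 2) * rt = 0"
    by (simp add: field_simps)
  from lin_indep[OF this] have "y = 0" "real_of_int (x * n) = of_int k" by auto
  then have "x * n = k" using of_int_eq_iff by blast
  then show ?thesis by auto
qed

lemma int_mem_qlat_iff: "of_int k \<in> qlat D n B \<longleftrightarrow> n dvd k"
proof
  assume "n dvd k"
  then obtain x where "k = x * n" by (metis dvdE mult.commute)
  then have "of_int k = of_int x * of_int n + of_int 0 * ((- of_int B + rt) / 2)" by simp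
  then show "of_int k \<in> qlat D n B" unfolding mem_qlat_iff by blast
qed (rule int_mem_qlat)

lemma real_mem_order:
  assumes "of_real r \<in> \<O>" shows "r \<in> \<int>"
proof -
  obtain x y where "of_real r = of_int x * of_int 1 + of_int y * ((- of_int D + rt) / 2)"
    using assms unfolding mem_qlat_iff by blast
  then have "of_real (of_int x - of_int y * of_int D / 2 - r) + of_real (of_int y / 2) * rt = 0"
    by (simp add: field_simps)
  from lin_indep[OF this] have "r = of_int x" by auto
  then show ?thesis by simp
qed

lemma cnj_qlat_subset: "cnj ` qlat D n B \<subseteq> qlat D n (- B)"
proof
  fix z assume "z \<in> cnj ` qlat D n B"
  then obtain w where "z = cnj w" "w \<in> qlat D n B" by blast
  then obtain x y where "z = cnj (of_int x * of_int n + of_int y * ((- of_int B + rt) / 2))"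
    unfolding mem_qlat_iff by blast
  then have "z = of_int x * of_int n + of_int (-y) * ((- of_int (- B) + rt) / 2)"
    by (simp add: field_simps)
  then show "z \<in> qlat D n (- B)" unfolding mem_qlat_iff by blast
qed

lemma cnj_mem_order: "z \<in> \<O> \<Longrightarrow> cnj z \<in> \<O>"
  using cnj_qlat_subset[of 1 D] qlat_cong[of 1 "- D" D] by auto

text \<open>The product of the second generators is -B b - n n' c with b the common generator, which
  falls back into the lattice. For n = 1 this says that \<open>qlat D n' B\<close> is a module over
  the order.\<close>

lemma lat_prod_qlat_subset:
  assumes "B * B - D = 4 * (n * n' * c)"
  shows "x \<in> qlat D n B \<Longrightarrow> y \<in> qlat D n' B \<Longrightarrow> x * y \<in> qlat D (n * n') B"
proof -
  let ?b = "(- of_int B + rt) / 2"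
  assume "x \<in> qlat D n B" "y \<in> qlat D n' B"
  then obtain x1 y1 x2 y2 where
    "x = of_int x1 * of_int n + of_int y1 * ?b" "y = of_int x2 * of_int n' + of_int y2 * ?b"
    unfolding mem_qlat_iff by blast
  then have "x * y = of_int (x1 * x2 * (n * n')) + of_int (x1 * y2 * n + x2 * y1 * n') * ?b
      + of_int (y1 * y2) * (?b * ?b)"
    by (simp add: algebra_simps)
  also have "\<dots> = of_int (x1 * x2 - y1 * y2 * c) * of_int (n * n') +
      of_int (x1 * y2 * n + x2 * y1 * n' - y1 * y2 * B) * ?b"
    unfolding gen_sq[OF assms] by (simp add: algebra_simps)
  finally show ?thesis unfolding mem_qlat_iff by blast
qed

lemma qlat_gens: "of_int n \<in> qlat D n B" "(- of_int B + rt) / 2 \<in> qlat D n B"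
  by (simp_all add: qlat_eq)

text \<open>With b the common second generator, the product contains n b and n' b, hence b itself by
  Bezout.\<close>

lemma lat_prod_qlat:
  assumes c: "B * B - D = 4 * (n * n' * c)" and "coprime n n'"
  shows "lat_prod (qlat D n B) (qlat D n' B) = qlat D (n * n') B"
proof
  show "lat_prod (qlat D n B) (qlat D n' B) \<subseteq> qlat D (n * n') B"
    by (rule lat_prod_least) (use lat_prod_qlat_subset[OF c] add_subgrpD[OF add_subgrp_qlat] in auto)
  let ?b = "(- of_int B + rt) / 2" and ?P = "lat_prod (qlat D n B) (qlat D n' B)"
  have P: "add_subgrp ?P" by (simp add: add_subgrp_lat_prod)
  obtain u v where uv: "u * n + v * n' = 1"
    using \<open>coprime n n'\<close> by (metis bezout_int coprime_imp_gcd_eq_1)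
  have "of_int n * ?b \<in> ?P" "?b * of_int n' \<in> ?P"
    by (intro lat_prod_mult qlat_gens)+
  then have "of_int u * (of_int n * ?b) + of_int v * (?b * of_int n') \<in> ?P"
    by (rule add_subgrpD(2)[OF P add_subgrp_of_int_mult[OF P] add_subgrp_of_int_mult[OF P]])
  also have "of_int u * (of_int n * ?b) + of_int v * (?b * of_int n') = of_int (u * n + v * n') * ?b"
    by (simp add: algebra_simps)
  finally have "?b \<in> ?P" by (simp add: uv)
  moreover have "of_int (n * n') \<in> ?P" using lat_prod_mult[OF qlat_gens(1) qlat_gens(1)] by simp
  ultimately show "qlat D (n * n') B \<subseteq> ?P"
    unfolding qlat_eq[of "n * n'" B] by (intro int_span_subset[OF P])
qed

text \<open>The product contains n times each of n, B and c: nB is a difference of mixed products of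
  generators, and -nc is the product of the two second generators. As n, B, c have gcd 1, it
  contains n. The gcd condition is primitivity of the form n x^2 + B x y + c y^2.\<close>

lemma lat_prod_qlat_conj:
  assumes c: "B * B - D = 4 * (n * c)" and "gcd n (gcd B c) = 1"
  shows "lat_prod (qlat D n B) (qlat D n (- B)) = (*) (of_int n) ` \<O>"
proof
  have O: "\<O> = qlat D 1 B" using c by (intro order_eq_qlat) simp
  let ?b = "(- of_int B + rt) / 2" and ?b' = "(of_int B + rt) / 2"
    and ?P = "lat_prod (qlat D n B) (qlat D n (- B))"
  have P: "add_subgrp ?P" by (simp add: add_subgrp_lat_prod)
  have nO: "(*) (of_int n) ` \<O> = int_span (of_int n) (of_int n * ?b)"
    unfolding O unfolding qlat_eq int_span_scale by simp
  show "?P \<subseteq> (*) (of_int n) ` \<O>"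
  proof (rule lat_prod_least)
    fix x y assume "x \<in> qlat D n B" "y \<in> qlat D n (- B)"
    then obtain x1 y1 x2 y2 where
      xy: "x = of_int x1 * of_int n + of_int y1 * ?b" "y = of_int x2 * of_int n + of_int y2 * ?b'"
      unfolding mem_qlat_iff by auto
    have "x * y = of_int (x1 * x2 * n) * of_int n + of_int n * (of_int (x1 * y2 + x2 * y1) * ?b)
        + of_int (x1 * y2 * B) * of_int n + of_int (y1 * y2) * (?b * ?b')"
      unfolding xy by (simp add: field_simps)
    also have "\<dots> = of_int (x1 * x2 * n + x1 * y2 * B - y1 * y2 * c) * of_int n +
        of_int (x1 * y2 + x2 * y1) * (of_int n * ?b)"
      unfolding gen_norm[OF c] by (simp add: algebra_simps)
    finally show "x * y \<in> (*) (of_int n) ` \<O>" unfolding nO by (rule int_spanI)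
  qed (simp add: nO add_subgrpD)
  have gens: "of_int n * of_int n \<in> ?P" "of_int n * ?b' \<in> ?P" "?b * of_int n \<in> ?P" "?b * ?b' \<in> ?P"
    by (rule lat_prod_mult; use qlat_gens(2)[of B n] qlat_gens(2)[of "- B" n] in \<open>simp add: qlat_gens(1)\<close>)+
  have "of_int n * ?b' - ?b * of_int n \<in> ?P" using gens by (intro add_subgrpD[OF P])
  then have nB: "of_int n * of_int B \<in> ?P" by (simp add: field_simps)
  have nc: "- of_int (n * c) \<in> ?P" using gens(4) gen_norm[OF c] by simp
  obtain u v where uv: "u * B + v * c = gcd B c" using bezout_int by blast
  obtain u' v' where uv': "u' * n + v' * gcd B c = 1" using bezout_int assms(2) by metis
  have "of_int u' * (of_int n * of_int n) + of_int (v' * u) * (of_int n * of_int B)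
      - of_int (v' * v) * (- of_int (n * c)) \<in> ?P"
    by (rule add_subgrpD(4)[OF P add_subgrpD(2)[OF P]]; rule add_subgrp_of_int_mult[OF P]; fact)
  also have "of_int u' * (of_int n * of_int n) + of_int (v' * u) * (of_int n * of_int B)
      - of_int (v' * v) * (- of_int (n * c)) = of_int n * (of_int (u' * n + v' * (u * B + v * c)) :: complex)"
    by (simp add: algebra_simps)
  finally have "of_int n \<in> ?P" by (simp only: uv uv' of_int_1 mult_1_right)
  then show "(*) (of_int n) ` \<O> \<subseteq> ?P"
    unfolding nO using gens(3) by (intro int_span_subset[OF P]) (simp_all add: mult.commute)
qed

lemma order_mult_qlat:
  assumes "B * B - D = 4 * (n * c)" "r \<in> \<O>" "x \<in> qlat D n B"
  shows "r * x \<in> qlat D n B"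
  using lat_prod_qlat_subset[of B 1 n c r x] order_eq_qlat[of B] assms by simp

lemma disc_sq: "\<exists>k. D * D - D = 4 * (1 * k)"
  using disc_cong by auto

section \<open>Arithmetic of the field and denominators\<close>

lemma K_of_rat_mult:
  assumes "z \<in> K" shows "of_rat q * z \<in> K"
proof -
  obtain x y where "z = of_rat x + of_rat y * rt" using assms unfolding mem_K_iff by blast
  then have "of_rat q * z = of_rat (q * x) + of_rat (q * y) * rt" by (simp add: of_rat_mult algebra_simps)
  then show ?thesis unfolding mem_K_iff by blast
qed

lemma qlat_subset_K: "qlat D n B \<subseteq> K"
proof
  fix z assume "z \<in> qlat D n B"
  then obtain x y where "z = of_int x * of_int n + of_int y * ((- of_int B + rt) / 2)"
    unfolding mem_qlat_iff by blast
  then have "z = of_rat (of_int x * of_int n - of_int y * of_int B / 2) + of_rat (of_int y / 2) * rt"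
    by (simp add: of_rat_diff of_rat_mult of_rat_divide field_simps)
  then show "z \<in> K" unfolding mem_K_iff by blast
qed

lemma K_mult:
  assumes "z \<in> K" "w \<in> K" shows "z * w \<in> K"
proof -
  obtain x y x' y' where "z = of_rat x + of_rat y * rt" "w = of_rat x' + of_rat y' * rt"
    using assms unfolding mem_K_iff by blast
  then have "z * w = of_rat (x * x') + of_rat (y * y') * (rt * rt) + of_rat (x * y' + x' * y) * rt"
    by (simp add: of_rat_mult of_rat_add algebra_simps)
  also have "\<dots> = of_rat (x * x' + y * y' * of_int D) + of_rat (x * y' + x' * y) * rt"
    unfolding rt_sq by (simp add: of_rat_mult of_rat_add algebra_simps)
  finally show ?thesis unfolding mem_K_iff by blast
qed

lemma K_inverse:
  assumes "z \<in> K" shows "inverse z \<in> K"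
proof -
  obtain x y where z: "z = of_rat x + of_rat y * rt" using assms unfolding mem_K_iff by blast
  let ?w = "of_rat x + of_rat (- y) * rt :: complex"
  have "z * ?w = of_rat x * of_rat x - of_rat y * of_rat y * (rt * rt)"
    by (simp add: z of_rat_minus algebra_simps)
  also have "\<dots> = of_rat (x * x - y * y * of_int D)"
    unfolding rt_sq by (simp add: of_rat_mult of_rat_diff)
  finally have zw: "z * ?w = of_rat (x * x - y * y * of_int D)" .
  have "cnj (of_rat q) = of_rat q" for q
    by (cases q) (simp add: of_rat_rat)
  then have "?w = cnj z" unfolding z by (simp add: of_rat_minus)
  show ?thesis
  proof (cases "z = 0")
    case False
    then have "?w \<noteq> 0" using \<open>?w = cnj z\<close> by simp
    then have "inverse z = inverse (z * ?w) * ?w" using False by simp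
    then have "inverse z = of_rat (inverse (x * x - y * y * of_int D)) * ?w"
      unfolding zw of_rat_inverse .
    moreover have "?w \<in> K" unfolding mem_K_iff by blast
    ultimately show ?thesis using K_of_rat_mult by simp
  qed (use assms in simp)
qed

lemma K_denominator:
  assumes "z \<in> K" shows "\<exists>r\<in>\<O>. r \<noteq> 0 \<and> r * z \<in> \<O>"
proof -
  obtain x y where z: "z = of_rat x + of_rat y * rt" using assms unfolding mem_K_iff by blast
  obtain m n where x: "x = of_int m / of_int n" "n > 0"
    by (metis Fract_of_int_quotient quotient_of_div quotient_of_denom_pos prod.exhaust)
  obtain m' n' where y: "y = of_int m' / of_int n'" "n' > 0"
    by (metis Fract_of_int_quotient quotient_of_div quotient_of_denom_pos prod.exhaust)
  \<comment> \<open>The coordinates come from \<surd>D = 2 b + D, with b = (-D + \<surd>D)/2 the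
    second generator of the order.\<close>
  have "of_int (n * n') * z = of_int (m * n' + n * m' * D) * of_int 1 + of_int (2 * n * m') * ((- of_int D + rt) / 2)"
    unfolding z x(1) y(1) using x(2) y(2) by (simp add: of_rat_divide field_simps)
  then have "of_int (n * n') * z \<in> \<O>" unfolding mem_qlat_iff by blast
  moreover have "of_int (n * n') \<in> \<O>" "of_int (n * n') \<noteq> (0::complex)"
    using x y by (simp_all only: int_mem_qlat_iff one_dvd of_int_eq_0_iff) auto
  ultimately show ?thesis by blast
qed

sublocale order_in_field K \<O>
proof
  fix x y
  show "1 \<in> \<O>" using int_mem_qlat_iff[of 1 1 D] by simp
  show "x * y \<in> \<O>" if "x \<in> \<O>" "y \<in> \<O>" using disc_sq order_mult_qlat that by metis
  show "x + y \<in> K" if xy: "x \<in> K" "y \<in> K"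
  proof -
    obtain a b where "x = of_rat a + of_rat b * rt"
      using xy(1) unfolding mem_K_iff by blast
    moreover obtain a' b' where "y = of_rat a' + of_rat b' * rt"
      using xy(2) unfolding mem_K_iff by blast
    ultimately have "x + y = of_rat (a + a') + of_rat (b + b') * rt" by (simp add: of_rat_add algebra_simps)
    then show ?thesis unfolding mem_K_iff by blast
  qed
qed (use qlat_subset_K K_mult K_inverse K_denominator in auto)

section \<open>The lattices as invertible fractional ideals\<close>

lemma qlat_subset_order:
  assumes "B * B - D = 4 * (n * c)" shows "qlat D n B \<subseteq> \<O>"
proof -
  have "\<O> = qlat D 1 B" using assms by (intro order_eq_qlat) simp
  moreover have "qlat D n B \<subseteq> qlat D 1 B"
    unfolding qlat_eq[of n B]
    by (rule int_span_subset[OF add_subgrp_qlat _ qlat_gens(2)]) (simp add: int_mem_qlat_iff)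
  ultimately show ?thesis by simp
qed

lemma fractional_qlat:
  assumes "B * B - D = 4 * (n * c)" "n > 0"
  shows "fractional_ideal K \<O> (qlat D n B)"
proof -
  have "qlat D n B \<subseteq> \<O>" by (rule qlat_subset_order[OF assms(1)])
  then have "\<forall>x\<in>qlat D n B. 1 * x \<in> \<O>" by auto
  then have "\<exists>r\<in>\<O>. r \<noteq> 0 \<and> (\<forall>x\<in>qlat D n B. r * x \<in> \<O>)" using order_one one_neq_zero by blast
  moreover have "of_int n \<noteq> (0 :: complex)" using assms(2) by simp
  then have "\<exists>x\<in>qlat D n B. x \<noteq> 0" using qlat_gens(1)[of n B] by blast
  ultimately show ?thesis
    unfolding fractional_ideal_iff
    by (intro conjI qlat_subset_K add_subgrp_qlat ballI order_mult_qlat[OF assms(1)])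
qed

text \<open>The inverse is the conjugate lattice \<open>qlat D n (- B)\<close> divided by n.\<close>

lemma qlat_in_ideal_group:
  assumes "B * B - D = 4 * (n * c)" "gcd n (gcd B c) = 1" "n > 0"
  shows "qlat D n B \<in> carrier (ideal_group K \<O>)"
proof -
  have n: "of_int n \<in> K" "of_int n \<noteq> (0 :: complex)" using order_subset int_mem_qlat_iff[of n 1 D] assms by auto
  let ?J = "(*) (inverse (of_int n)) ` qlat D n (- B)"
  have "lat_prod (qlat D n B) ?J = \<O>"
    using n lat_prod_qlat_conj[OF assms(1,2)] by (simp add: lat_prod_scale_right scale_scale)
  moreover have "fractional_ideal K \<O> ?J"
    using n fractional_qlat[of "- B" n c] assms by (intro fractional_ideal_scale K_inverse) auto
  ultimately show ?thesis using fractional_qlat[OF assms(1,3)] unfolding carrier_ideal_group by blast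
qed

end

section \<open>Forms and their ideals\<close>

text \<open>The determinant is 1, so Cramer's rule recovers u and v with integer coefficients. The
  pattern of signs is the one that arises when u = a, v = \<beta> and the first new generator is p a
  - r \<beta>.\<close>

lemma int_span_unimodular:
  assumes "p * s - q * r = (1 :: int)"
  shows "int_span (of_int p * u - of_int r * v) (of_int s * v - of_int q * u) = int_span u v"
proof
  let ?u = "of_int p * u - of_int r * v" and ?v = "of_int s * v - of_int q * u"
  have "?u = of_int p * u + of_int (- r) * v" "?v = of_int (- q) * u + of_int s * v" by simp_all
  then show "int_span ?u ?v \<subseteq> int_span u v"
    by (intro int_span_subset) (auto intro: int_spanI simp only: add_subgrp_int_span)
  have "of_int s * ?u + of_int r * ?v = of_int (p * s - q * r) * u"
    "of_int q * ?u + of_int p * ?v = of_int (p * s - q * r) * v"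
    by (simp_all add: algebra_simps)
  then have "u = of_int s * ?u + of_int r * ?v" "v = of_int q * ?u + of_int p * ?v"
    unfolding assms by simp_all
  then show "int_span u v \<subseteq> int_span ?u ?v"
    by (intro int_span_subset) (blast intro: int_spanI add_subgrp_int_span)+
qed

context quad_order
begin

lemma K_of_int: "of_int n \<in> K"
  using qlat_subset_K qlat_gens(1) by blast

text \<open>
  With \<open>\<tau>\<close> the root of \<open>f\<close> in the upper half plane, the root \<open>\<tau>'\<close> of the transformed form satisfies
  \<open>\<tau> = (p \<tau>' + q) / (r \<tau>' + s)\<close>, and the lattices \<open>\<int> + \<int> \<tau>\<close> and \<open>\<int> + \<int> \<tau>'\<close> differ by the
  factor \<open>p - r \<tau>\<close>.
\<close>

lemma qlat_transform:
  assumes disc: "b * b - D = 4 * (a * c)" and det: "p * s - q * r = 1"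
    and a': "a' = a * p * p + b * p * r + c * r * r"
    and b': "b' = 2 * a * p * q + b * (p * s + q * r) + 2 * c * r * s"
    and nz: "a \<noteq> 0" "a' \<noteq> 0"
  shows "\<exists>z\<in>K. z \<noteq> 0 \<and> qlat D a' b' = (*) z ` qlat D a b"
proof -
  define \<beta> where "\<beta> = (- of_int b + rt) / 2"
  have \<beta>_sq: "\<beta> * \<beta> = - of_int b * \<beta> - of_int (a * c)"
    using gen_sq[OF disc] by (simp add: \<beta>_def)
  have rt: "rt = 2 * \<beta> + of_int b" by (simp add: \<beta>_def)
  \<comment> \<open>\<gamma> is the conjugate of p a - r \<beta>, so their product is the norm of p
    a - r \<beta>, which equals a f(p, r) = a a'.\<close>
  define \<gamma> where "\<gamma> = of_int (p * a + r * b) + of_int r * \<beta>"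
  have 1: "\<gamma> * (of_int p * of_int a - of_int r * \<beta>) = of_int a * of_int a'"
  proof -
    have "\<gamma> * (of_int p * of_int a - of_int r * \<beta>) =
      of_int (p * a + r * b) * of_int (p * a) - of_int (r * r * b) * \<beta> - of_int (r * r) * (\<beta> * \<beta>)"
      unfolding \<gamma>_def by (simp add: algebra_simps)
    also have "\<dots> = of_int a * of_int a'" unfolding \<beta>_sq a' by (simp add: algebra_simps)
    finally show ?thesis .
  qed
  have 2: "\<gamma> * (of_int s * \<beta> - of_int q * of_int a) = of_int a * ((- of_int b' + rt) / 2)"
  proof -
    have "\<gamma> * (of_int s * \<beta> - of_int q * of_int a) =
      of_int (s * (p * a + r * b) - r * q * a) * \<beta> - of_int (p * a + r * b) * of_int (q * a)
      + of_int (r * s) * (\<beta> * \<beta>)"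
      unfolding \<gamma>_def by (simp add: algebra_simps)
    also have "\<dots> = of_int (a * (p * s - q * r)) * \<beta> - of_int a * of_int (p * a * q + r * b * q + r * s * c)"
      unfolding \<beta>_sq by (simp add: algebra_simps)
    also have "\<dots> = of_int a * (\<beta> - of_int (p * a * q + r * b * q + r * s * c))"
      unfolding det by (simp add: algebra_simps)
    also have "b' = b * (p * s - q * r) + 2 * (p * a * q + r * b * q + r * s * c)"
      unfolding b' by (simp add: algebra_simps)
    then have "b' = b + 2 * (p * a * q + r * b * q + r * s * c)" unfolding det by simp
    then have "\<beta> - of_int (p * a * q + r * b * q + r * s * c) = (- of_int b' + rt) / 2"
      unfolding rt by simp
    finally show ?thesis .
  qed
  have "(*) \<gamma> ` qlat D a b = int_span (\<gamma> * (of_int p * of_int a - of_int r * \<beta>)) (\<gamma> * (of_int s * \<beta> - of_int q * of_int a))"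
    unfolding qlat_eq int_span_scale[symmetric] int_span_unimodular[OF det] \<beta>_def ..
  also have "\<dots> = (*) (of_int a) ` qlat D a' b'"
    unfolding 1 2 qlat_eq int_span_scale ..
  finally have "(*) (inverse (of_int a)) ` ((*) \<gamma> ` qlat D a b) = (*) (inverse (of_int a)) ` ((*) (of_int a) ` qlat D a' b')"
    by simp
  then have "(*) (inverse (of_int a) * \<gamma>) ` qlat D a b = qlat D a' b'"
    using nz by (simp add: scale_scale)
  moreover have "\<gamma> \<noteq> 0" using 1 nz by auto
  moreover have "\<beta> \<in> K" using qlat_gens(2)[of b a] qlat_subset_K unfolding \<beta>_def by blast
  then have "inverse (of_int a) * \<gamma> \<in> K"
    unfolding \<gamma>_def by (intro K_mult K_inverse field_add K_of_int)
  ultimately show ?thesis using nz by (intro bexI[of _ "inverse (of_int a) * \<gamma>"]) auto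
qed

lemma cnj_qlat: "cnj ` qlat D n B = qlat D n (- B)"
proof
  show "qlat D n (- B) \<subseteq> cnj ` qlat D n B"
    using image_mono[OF cnj_qlat_subset[of n "- B"], of cnj] by (simp add: image_image)
qed (rule cnj_qlat_subset)

text \<open>Multiplying each lattice by its conjugate turns the homothety into an equality of the
  principal ideals generated by a and by N(z) m, where N(z) = z \<open>cnj z\<close>. Their ratio t
  is real and, with its inverse, lies in the order; so t and 1/t are integers, and t > 0 forces t =
  1. The element z m of \<open>qlat D a b\<close> then has norm a m, while x a + y \<beta> has norm
  a f(x, -y); the sign comes from the trace -b of \<beta>.\<close>

lemma represents_of_scaled:
  assumes disc: "b * b - D = 4 * (a * c)" "gcd a (gcd b c) = 1" "a > 0"
    and disc': "B * B - D = 4 * (m * C)" "gcd m (gcd B C) = 1" "m > 0"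
    and z: "z \<noteq> 0" "qlat D a b = (*) z ` qlat D m B"
  shows "\<exists>x y. a * x\<^sup>2 + b * x * y + c * y\<^sup>2 = m"
proof -
  have "qlat D a (- b) = cnj ` ((*) z ` qlat D m B)"
    using cnj_qlat[of a b] z by simp
  also have "\<dots> = (*) (cnj z) ` qlat D m (- B)"
    unfolding cnj_qlat[symmetric] by (simp add: image_image)
  finally have conj: "qlat D a (- b) = (*) (cnj z) ` qlat D m (- B)" .
  have "(*) (of_int a) ` \<O> = lat_prod ((*) z ` qlat D m B) ((*) (cnj z) ` qlat D m (- B))"
    unfolding lat_prod_qlat_conj[OF disc(1,2), symmetric] conj z(2) ..
  also have "\<dots> = (*) (z * cnj z * of_int m) ` \<O>"
    unfolding lat_prod_scale lat_prod_scale_right lat_prod_qlat_conj[OF disc'(1,2)] scale_scale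
    by (simp only: mult.left_commute[of "cnj z" z] mult.assoc)
  finally have eq: "(*) (of_int a) ` \<O> = (*) (z * cnj z * of_int m) ` \<O>" .
  define t where "t = (cmod z)\<^sup>2 * of_int m / of_int a"
  have t: "z * cnj z * of_int m = of_int a * of_real t"
    using disc(3) by (simp add: t_def complex_norm_square[symmetric])
  have "t > 0" using disc(3) disc'(3) z(1) by (simp add: t_def)
  have a0: "of_int a \<noteq> (0::complex)" using disc(3) by simp
  have "of_int a * of_real t \<in> (*) (of_int a) ` \<O>" "of_int a \<in> (*) (of_int a * of_real t) ` \<O>"
    using eq order_one unfolding t by (force simp: image_iff)+
  then obtain r r' where r: "r \<in> \<O>" "of_int a * of_real t = of_int a * r"
      "r' \<in> \<O>" "of_int a = of_int a * of_real t * r'"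
    by blast
  have "of_real t * r' = 1" using r(4) a0 by (simp add: mult.assoc)
  then have "r' = of_real (1 / t)" using \<open>t > 0\<close> by (simp add: field_simps)
  then have "of_real t \<in> \<O>" "of_real (1 / t) \<in> \<O>"
    using r a0 by auto
  then have "t \<in> \<int>" "1 / t \<in> \<int>" using real_mem_order by blast+
  then obtain i j where ij: "t = of_int i" "1 / t = of_int j" by (auto elim!: Ints_cases)
  have "real_of_int (i * j) = 1" using ij \<open>t > 0\<close> by (simp add: field_simps)
  then have "i * j = 1" by linarith
  then have "t = 1" using \<open>t > 0\<close> ij by (auto simp: zmult_eq_1_iff)
  then have norm: "z * cnj z * of_int m = of_int a" using t by simp
  define \<beta> where "\<beta> = (- of_int b + rt) / 2"
  have "z * of_int m \<in> qlat D a b" using z(2) qlat_gens(1) by blast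
  then obtain x y where xy: "z * of_int m = of_int x * of_int a + of_int y * \<beta>"
    unfolding mem_qlat_iff \<beta>_def by blast
  have "of_int (m * a) = (z * of_int m) * cnj (z * of_int m)"
    using norm by (simp add: algebra_simps)
  also have "\<dots> = of_int (x * x * a * a) + of_int (x * y * a) * (\<beta> + cnj \<beta>) + of_int (y * y) * (\<beta> * cnj \<beta>)"
    unfolding xy by (simp add: algebra_simps)
  also have "\<beta> + cnj \<beta> = of_int (- b)" by (simp add: \<beta>_def field_simps)
  also have "\<beta> * cnj \<beta> = of_int (a * c)"
    using gen_norm[OF disc(1)] by (simp add: \<beta>_def field_simps)
  also have "of_int (x * x * a * a) + of_int (x * y * a) * of_int (- b) + of_int (y * y) * of_int (a * c)
      = (of_int ((a * x\<^sup>2 + b * x * (- y) + c * (- y)\<^sup>2) * a) :: complex)"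
    by (simp add: algebra_simps power2_eq_square)
  finally have "m * a = (a * x\<^sup>2 + b * x * (- y) + c * (- y)\<^sup>2) * a" by (simp only: of_int_eq_iff)
  then have "a * x\<^sup>2 + b * x * (- y) + c * (- y)\<^sup>2 = m" using disc(3) by simp
  then show ?thesis by blast
qed

text \<open>A common prime q gives q^2 dvd B^2 - 4 m C = D. As q divides m it is prime to g, so q^2
  divides the square-free d.\<close>

lemma gcd_disc_one:
  assumes disc: "B * B - D = 4 * (m * C)" and "coprime (int g) m"
  shows "gcd m (gcd B C) = 1"
proof (rule ccontr)
  assume "gcd m (gcd B C) \<noteq> 1"
  then obtain q where q: "prime q" "q dvd gcd m (gcd B C)"
    using prime_factor_int[of "gcd m (gcd B C)"] by (metis abs_of_nonneg gcd_ge_0_int)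
  then have "q dvd m" "q dvd B" "q dvd C" by auto
  then have "q * q dvd B * B - 4 * (m * C)" by (intro dvd_diff dvd_mult mult_dvd_mono) auto
  then have "q * q dvd D" using disc by (simp add: algebra_simps)
  then have "q\<^sup>2 dvd (int g)\<^sup>2 * int d" by (simp add: D_eq power2_eq_square)
  moreover have "coprime (q\<^sup>2) ((int g)\<^sup>2)"
    using q \<open>q dvd m\<close> assms(2) by (meson coprime_commute coprime_divisors coprime_power_left_iff coprime_power_right_iff dvd_refl)
  ultimately have "q\<^sup>2 dvd int d" by (simp add: coprime_dvd_mult_right_iff)
  then have "(nat q)\<^sup>2 dvd d" using q by (metis int_dvd_int_iff int_nat_eq of_nat_power prime_ge_0_int)
  then have "nat q dvd 1" using sqf unfolding squarefree_def by blast
  then show False using q by (auto simp: prime_int_iff)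
qed

lemma represented_qlat_class:
  assumes disc: "b * b - D = 4 * (a * c)" "gcd a (gcd b c) = 1" "a > 0"
    and m: "squarefree m" "m > 0" "coprime (int g) m" "a * x\<^sup>2 + b * x * y + c * y\<^sup>2 = m"
  obtains B C where "B * B - D = 4 * (m * C)"
    "ideal_class K \<O> (qlat D a b) = ideal_class K \<O> (qlat D m B)"
proof -
  \<comment> \<open>f is homogeneous of degree 2, so the squared gcd divides the value m, and m is
    square-free.\<close>
  have "(gcd x y)\<^sup>2 dvd m"
    unfolding m(4)[symmetric]
    unfolding power2_eq_square mult.assoc by (intro dvd_add dvd_mult mult_dvd_mono) auto
  then have "gcd x y = 1" using m(1) by (auto simp: squarefree_def)
  then obtain s q' where "s * x + q' * y = 1" using bezout_int by metis
  then have det: "x * s - (- q') * y = 1" by (simp add: algebra_simps)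
  \<comment> \<open>The matrix with columns (x, y) and (-q', s) has determinant 1. B and C are the
    remaining coefficients of f transformed by it, whose leading coefficient is f(x, y) = m.\<close>
  define B where "B = 2 * a * x * (- q') + b * (x * s + (- q') * y) + 2 * c * y * s"
  define C where "C = a * q' * q' - b * q' * s + c * s * s"
  have m': "m = a * x * x + b * x * y + c * y * y" using m(4) by (simp add: power2_eq_square)
  have "B * B - 4 * (m * C) = (b * b - 4 * (a * c)) * (x * s - (- q') * y)\<^sup>2"
    unfolding B_def C_def m' by (simp add: algebra_simps power2_eq_square)
  then have dB: "B * B - D = 4 * (m * C)" unfolding det using disc(1) by (simp add: algebra_simps)
  obtain z where "z \<in> K" "z \<noteq> 0" "qlat D m B = (*) z ` qlat D a b"
    using qlat_transform[OF disc(1) det m' B_def] disc(3) m(2) by auto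
  then have "ideal_class K \<O> (qlat D m B) = ideal_class K \<O> (qlat D a b)"
    using ideal_class_eq_iff[OF qlat_in_ideal_group[OF dB gcd_disc_one[OF dB m(3)] m(2)]
        qlat_in_ideal_group[OF disc]] by blast
  then show ?thesis using that dB by metis
qed

text \<open>By \<open>qlat_transform\<close> all members of the form class have homothetic lattices,
  so \<open>the_elem\<close> is applied to a singleton; f itself is one of the members.\<close>

lemma ideal_class_of_bqf_class_eq:
  assumes f: "(a, b, c) \<in> bqf_forms D"
  shows "ideal_class_of_bqf_class K \<O> (bqf_class (a, b, c)) = ideal_class K \<O> (qlat D a b)"
proof -
  have form: "b * b - D = 4 * (a * c)" "gcd a (gcd b c) = 1" "a > 0"
    if "(a, b, c) \<in> bqf_forms D" for a b c
  proof -
    have "\<forall>x y. (x, y) \<noteq> (0, 0) \<longrightarrow> bqf_eval (a, b, c) x y > 0"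
      using that unfolding bqf_forms_def bqf_pos_def_def by simp
    then have "bqf_eval (a, b, c) 1 0 > 0" by (metis prod.inject one_neq_zero)
    then show "a > 0" by simp
    have "bqf_primitive (a, b, c)" "bqf_disc (a, b, c) = D" using that by (auto simp: bqf_forms_def)
    then show "gcd a (gcd b c) = 1" "b * b - D = 4 * (a * c)" by (simp_all add: power2_eq_square)
  qed
  have disc: "bqf_disc (a, b, c) = D" using f by (simp add: bqf_forms_def)
  have eq: "ideal_class K \<O> (bqf_ideal h) = ideal_class K \<O> (qlat D a b)"
    if h: "h \<in> bqf_class (a, b, c)" for h
  proof -
    obtain a' b' c' where h_eq: "h = (a', b', c')" by (metis prod_cases3)
    obtain p q r s where *: "(a', b', c') \<in> bqf_forms D" "p * s - q * r = 1"
      "\<And>x y. bqf_eval (a', b', c') x y = bqf_eval (a, b, c) (p * x + q * y) (r * x + s * y)"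
      using h unfolding bqf_class_def disc proper_equiv_def h_eq by auto
    have a': "a' = a * p * p + b * p * r + c * r * r"
      using *(3)[of 1 0] by (simp add: power2_eq_square)
    have c': "c' = a * q * q + b * q * s + c * s * s"
      using *(3)[of 0 1] by (simp add: power2_eq_square)
    have b': "b' = 2 * a * p * q + b * (p * s + q * r) + 2 * c * r * s"
      using *(3)[of 1 1] unfolding a' c' by (simp add: power2_eq_square algebra_simps)
    have h_ideal: "bqf_ideal h = qlat D a' b'"
      using form(1)[OF *(1)] by (simp add: h_eq qlat_def power2_eq_square algebra_simps)
    obtain z where "z \<in> K" "z \<noteq> 0" "qlat D a' b' = (*) z ` qlat D a b"
      using qlat_transform[OF form(1)[OF f] *(2) a' b'] form(3)[OF f] form(3)[OF *(1)] by auto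
    then show ?thesis unfolding h_ideal
      using ideal_class_eq_iff[OF qlat_in_ideal_group[OF form[OF *(1)]] qlat_in_ideal_group[OF form[OF f]]]
      by blast
  qed
  have "(a, b, c) \<in> bqf_class (a, b, c)"
    unfolding bqf_class_def disc proper_equiv_def using f
    by simp (rule exI[of _ 1], rule exI[of _ 0], rule exI[of _ 0], rule exI[of _ 1], simp)
  then have "(\<lambda>h. ideal_class K \<O> (bqf_ideal h)) ` bqf_class (a, b, c) = {ideal_class K \<O> (qlat D a b)}"
    using eq by blast
  then show ?thesis unfolding ideal_class_of_bqf_class_def by simp
qed

end

section \<open>Prime ideals\<close>

lemma as_ring_simps [simp]:
  "carrier (as_ring R) = R" "x \<otimes>\<^bsub>as_ring R\<^esub> y = x * y" "\<one>\<^bsub>as_ring R\<^esub> = 1"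
  "\<zero>\<^bsub>as_ring R\<^esub> = 0" "x \<oplus>\<^bsub>as_ring R\<^esub> y = x + y"
  by (simp_all add: as_ring_def ring_of_type_algebra_def)

lemma ideal_prod_as_ring: "ideal_prod (as_ring R) I J = lat_prod I J"
proof
  show "ideal_prod (as_ring R) I J \<subseteq> lat_prod I J"
  proof
    fix z assume "z \<in> ideal_prod (as_ring R) I J" then show "z \<in> lat_prod I J"
      by (induction rule: ideal_prod.induct) (auto intro: lat_prod_mult lat_prod_add)
  qed
  show "lat_prod I J \<subseteq> ideal_prod (as_ring R) I J"
    by (rule lat_prod_least)
      (use ideal_prod.prod[of _ I _ J "as_ring R"] ideal_prod.sum[of _ "as_ring R" I J] in auto)
qed

lemma PIdl_as_ring: "PIdl\<^bsub>as_ring R\<^esub> z = (*) z ` R"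
  unfolding cgenideal_def by (auto simp: mult.commute)

section \<open>Ideals of an order as sets of complex numbers, and their prime factors\<close>

context order_in_field
begin

lemma cring_as_ring: "cring (as_ring \<O>)"
proof -
  interpret C: cring complex_ring by (rule complex_cring)
  have "subring \<O> complex_ring"
    by (rule C.subringI) (use order_one order_mult order_subgrp in \<open>auto simp: add_subgrp_def\<close>)
  then have "subcring \<O> complex_ring" by (rule C.subcringI')
  then show ?thesis unfolding as_ring_def using C.subcring_iff[of \<O>] by simp
qed

lemma ideal_as_ring_iff:
  "ideal I (as_ring \<O>) \<longleftrightarrow> I \<subseteq> \<O> \<and> add_subgrp I \<and> (\<forall>r\<in>\<O>. \<forall>x\<in>I. r * x \<in> I)"
proof -
  interpret R: cring "as_ring \<O>" by (rule cring_as_ring)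
  have "\<ominus>\<^bsub>as_ring \<O>\<^esub> x = - x" if "x \<in> \<O>" for x
    using R.minus_equality[of "- x" x] that order_subgrp by (simp add: add_subgrp_def)
  then have inv: "inv\<^bsub>add_monoid (as_ring \<O>)\<^esub> x = - x" if "x \<in> \<O>" for x
    using that by (simp add: a_inv_def)
  have sub: "subgroup I (add_monoid (as_ring \<O>)) \<longleftrightarrow> I \<subseteq> \<O> \<and> add_subgrp I"
    using inv by (auto simp: subgroup_def add_subgrp_def subset_iff)
  show ?thesis
  proof
    assume "ideal I (as_ring \<O>)"
    then interpret ideal I "as_ring \<O>" .
    show "I \<subseteq> \<O> \<and> add_subgrp I \<and> (\<forall>r\<in>\<O>. \<forall>x\<in>I. r * x \<in> I)"
      using sub a_subgroup I_l_closed by auto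
  next
    assume I: "I \<subseteq> \<O> \<and> add_subgrp I \<and> (\<forall>r\<in>\<O>. \<forall>x\<in>I. r * x \<in> I)"
    show "ideal I (as_ring \<O>)"
    proof (rule idealI)
      fix x r assume "x \<in> I" "r \<in> carrier (as_ring \<O>)"
      then have "r * x \<in> I" using I by simp
      then show "r \<otimes>\<^bsub>as_ring \<O>\<^esub> x \<in> I" "x \<otimes>\<^bsub>as_ring \<O>\<^esub> r \<in> I"
        by (simp_all add: mult.commute)
    qed (use I sub R.ring_axioms in auto)
  qed
qed

lemma primeideal_as_ring_iff:
  "primeideal P (as_ring \<O>) \<longleftrightarrow> ideal P (as_ring \<O>) \<and> P \<noteq> \<O> \<and>
     (\<forall>x\<in>\<O>. \<forall>y\<in>\<O>. x * y \<in> P \<longrightarrow> x \<in> P \<or> y \<in> P)"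
  using cring_as_ring by (auto simp: primeideal_def primeideal_axioms_def)

lemma primeidealD:
  assumes "primeideal P (as_ring \<O>)"
  shows "P \<subseteq> \<O>" "add_subgrp P" "r \<in> \<O> \<Longrightarrow> x \<in> P \<Longrightarrow> r * x \<in> P" "1 \<notin> P"
    "x \<in> \<O> \<Longrightarrow> y \<in> \<O> \<Longrightarrow> x * y \<in> P \<Longrightarrow> x \<in> P \<or> y \<in> P"
proof -
  show *: "P \<subseteq> \<O>" "add_subgrp P" "r \<in> \<O> \<Longrightarrow> x \<in> P \<Longrightarrow> r * x \<in> P" for r x
    using assms unfolding primeideal_as_ring_iff ideal_as_ring_iff by auto
  show "x \<in> \<O> \<Longrightarrow> y \<in> \<O> \<Longrightarrow> x * y \<in> P \<Longrightarrow> x \<in> P \<or> y \<in> P"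
    using assms unfolding primeideal_as_ring_iff by auto
  show "1 \<notin> P"
  proof
    assume "1 \<in> P"
    then have "r \<in> P" if "r \<in> \<O>" for r using *(3)[OF that, of 1] by simp
    then show False using *(1) assms unfolding primeideal_as_ring_iff by blast
  qed
qed

lemma lat_prod_subset_left:
  assumes "primeideal P (as_ring \<O>)" "Q \<subseteq> \<O>"
  shows "lat_prod P Q \<subseteq> P"
proof (rule lat_prod_least)
  fix x y assume "x \<in> P" "y \<in> Q"
  then show "x * y \<in> P" using primeidealD(3)[OF assms(1), of y x] assms(2) by (auto simp: mult.commute)
qed (rule add_subgrpD(2)[OF primeidealD(2)[OF assms(1)]])

lemma scale_inj: "z \<noteq> 0 \<Longrightarrow> (*) z ` I = (*) z ` J \<longleftrightarrow> I = (J :: complex set)"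
  by (rule inj_image_eq_iff) (simp add: inj_def)

lemma lat_prod_prime: 
  assumes "primeideal P (as_ring \<O>)" shows "lat_prod \<O> P = P"
  by (rule lat_prod_unit) (use primeidealD[OF assms] order_one in auto)

text \<open>Only primality and cancellation of the principal factor z are used. From P Q = L L
  \<subseteq> L one of P, Q lies in L, say P. For x in L the square x x lies in P Q \<subseteq> P,
  so x lies in P; hence P = L, and Q is found by cancelling.\<close>

lemma prime_factors_unique:
  assumes P: "primeideal P (as_ring \<O>)" and Q: "primeideal Q (as_ring \<O>)"
    and L: "primeideal L (as_ring \<O>)" and z: "z \<noteq> 0" "(*) z ` \<O> = lat_prod P Q" "(*) z ` \<O> = lat_prod L L"
  shows "P = Q"
proof -
  have cancel: "P = Q" if "P \<subseteq> L" "primeideal P (as_ring \<O>)" "primeideal Q (as_ring \<O>)"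
    "(*) z ` \<O> = lat_prod P Q" for P Q
  proof -
    have "L \<subseteq> P"
    proof
      fix x assume x: "x \<in> L"
      have "lat_prod L L = lat_prod P Q" using z(3) that(4) by simp
      then have "x * x \<in> lat_prod P Q" using lat_prod_mult[OF x x] by simp
      then have "x * x \<in> P" using lat_prod_subset_left[OF that(2), of Q] primeidealD(1)[OF that(3)] by blast
      then show "x \<in> P" using primeidealD(1)[OF L] primeidealD(5)[OF that(2)] x by blast
    qed
    then have "P = L" using that(1) by blast
    \<comment> \<open>Since P P = L L = z \<O> and P Q = z \<O>, the two sides are z Q and z
      P.\<close>
    have "lat_prod (lat_prod P P) Q = lat_prod P (lat_prod P Q)" by (rule lat_prod_assoc)
    then have "(*) z ` lat_prod \<O> Q = (*) z ` lat_prod \<O> P"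
      using z(3) that(4) \<open>P = L\<close> by (metis lat_prod_comm lat_prod_scale)
    then show "P = Q" using lat_prod_prime that z(1) scale_inj by metis
  qed
  have "P \<subseteq> L \<or> Q \<subseteq> L"
  proof (rule ccontr)
    assume "\<not> (P \<subseteq> L \<or> Q \<subseteq> L)"
    then obtain x y where xy: "x \<in> P" "x \<notin> L" "y \<in> Q" "y \<notin> L" by blast
    have "lat_prod L L = lat_prod P Q" using z(2,3) by simp
    then have "x * y \<in> lat_prod L L" using lat_prod_mult[OF xy(1,3)] by simp
    then have "x * y \<in> L" using lat_prod_subset_left[OF L primeidealD(1)[OF L]] by blast
    then show False using xy primeidealD(1)[OF P] primeidealD(1)[OF Q] primeidealD(5)[OF L] by blast
  qed
  then show ?thesis using cancel[OF _ P Q z(2)] cancel[OF _ Q P] z(2) lat_prod_comm by metis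
qed

end

definition coset :: "complex set \<Rightarrow> complex \<Rightarrow> complex set" where
  "coset I z = (\<lambda>h. h + z) ` I"

lemma ideal_norm_coset: "ideal_norm R I = card (coset I ` R)"
proof -
  have "carrier (as_ring R Quot I) = coset I ` R"
    by (auto simp: FactRing_def A_RCOSETS_def RCOSETS_def r_coset_def coset_def image_iff)
  then show ?thesis by (simp add: ideal_norm_def)
qed

lemma coset_eq_iff:
  assumes "add_subgrp I" shows "coset I z = coset I w \<longleftrightarrow> z - w \<in> I"
proof
  assume "coset I z = coset I w"
  moreover have "z \<in> coset I z" using assms by (force simp: coset_def add_subgrp_def)
  ultimately show "z - w \<in> I" by (auto simp: coset_def)
next
  have sub: "coset I z \<subseteq> coset I w" if "z - w \<in> I" for z w
  proof
    fix x assume "x \<in> coset I z"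
    then obtain h where "h \<in> I" "x = h + z" by (auto simp: coset_def)
    then have "h + (z - w) \<in> I" "x = h + (z - w) + w" using that assms by (auto simp: add_subgrp_def)
    then show "x \<in> coset I w" unfolding coset_def by blast
  qed
  assume "z - w \<in> I"
  moreover from this have "w - z \<in> I" using add_subgrpD(3)[OF assms, of "z - w"] by simp
  ultimately show "coset I z = coset I w" using sub by blast
qed

section \<open>Prime ideals of prime norm, and factorizations of q\<close>

context quad_order
begin

text \<open>The second generator lies in the lattice, so only the integer coordinate of z matters,
  and only modulo n.\<close>

lemma qlat_residue:
  assumes "B * B - D = 4 * (n * c)" "n > 0" "z \<in> \<O>"
  obtains t where "0 \<le> t" "t < n" "z - of_int t \<in> qlat D n B"
proof -
  have "z \<in> qlat D 1 B" using assms order_eq_qlat[of B] by simp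
  then obtain x y where z: "z = of_int x * of_int 1 + of_int y * ((- of_int B + rt) / 2)"
    unfolding mem_qlat_iff by blast
  have "of_int x = (of_int (x div n * n + x mod n) :: complex)" by simp
  then have "z - of_int (x mod n) = of_int (x div n) * of_int n + of_int y * ((- of_int B + rt) / 2)"
    unfolding z by (simp only: of_int_add of_int_mult) simp
  then have "z - of_int (x mod n) \<in> qlat D n B" unfolding mem_qlat_iff by blast
  then show ?thesis using that[of "x mod n"] assms(2) by simp
qed

lemma inj_coset_int:
  assumes "add_subgrp P" "\<And>k. of_int k \<in> P \<Longrightarrow> int q dvd k"
  shows "inj_on (\<lambda>t. coset P (of_int t)) {0..<int q}"
proof (rule inj_onI)
  fix t u assume tu: "t \<in> {0..<int q}" "u \<in> {0..<int q}" "coset P (of_int t) = coset P (of_int u)"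
  then have "of_int (t - u) \<in> P" using coset_eq_iff[OF assms(1)] by simp
  then have "int q dvd t - u" by (rule assms(2))
  then have "t mod int q = u mod int q" by (simp add: mod_eq_dvd_iff)
  then show "t = u" using tu by simp
qed

text \<open>Modulo the lattice every element of the order is an integer, and the integers inside the
  lattice are the multiples of q. The quotient is thus \<int>/q: primality is Euclid's lemma, and 0,
  ..., q - 1 represent the cosets.\<close>

lemma prime_ideal_above_qlat:
  assumes q: "prime q" and disc: "B * B - D = 4 * (int q * k)"
  shows "prime_ideal_above \<O> q (qlat D (int q) B)"
  unfolding prime_ideal_above_def
proof (intro conjI)
  let ?P = "qlat D (int q) B"
  have q0: "int q > 0" using q by (simp add: prime_gt_0_nat)
  show "primeideal ?P (as_ring \<O>)"
    unfolding primeideal_as_ring_iff ideal_as_ring_iff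
  proof (intro conjI ballI impI)
    show "?P \<noteq> \<O>"
      using order_one int_mem_qlat_iff[of 1 "int q" B] q by (auto simp: prime_nat_iff)
    fix x y assume xy: "x \<in> \<O>" "y \<in> \<O>" "x * y \<in> ?P"
    obtain t where t: "x - of_int t \<in> ?P" using qlat_residue[OF disc q0 xy(1)] .
    obtain u where u: "y - of_int u \<in> ?P" using qlat_residue[OF disc q0 xy(2)] .
    have "of_int u \<in> \<O>" by (simp add: int_mem_qlat_iff)
    then have "y * (x - of_int t) \<in> ?P" "of_int t * (y - of_int u) \<in> ?P"
      using order_mult_qlat[OF disc] xy t u int_mem_qlat_iff[of t 1 D] by auto
    then have "x * y - y * (x - of_int t) - of_int t * (y - of_int u) \<in> ?P"
      using xy by (intro add_subgrpD(4)[OF add_subgrp_qlat])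
    then have "of_int (t * u) \<in> ?P" by (simp add: algebra_simps)
    then have "int q dvd t * u" by (simp only: int_mem_qlat_iff)
    then have "int q dvd t \<or> int q dvd u" using q prime_dvd_mult_iff[of "int q"] by simp
    then have "of_int t \<in> ?P \<or> of_int u \<in> ?P" by (simp add: int_mem_qlat_iff)
    then show "x \<in> ?P \<or> y \<in> ?P"
      using add_subgrpD(2)[OF add_subgrp_qlat t] add_subgrpD(2)[OF add_subgrp_qlat u] by fastforce
  qed (use order_mult_qlat[OF disc] qlat_subset_order[OF disc] in auto)
  show "lies_above ?P q"
    unfolding lies_above_def
  proof (intro equalityI subsetI)
    fix z :: complex assume "z \<in> ?P \<inter> \<int>"
    then obtain k where "z = of_int k" "int q dvd k" by (auto elim!: Ints_cases simp: int_mem_qlat_iff)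
    then show "z \<in> {of_int (int q * z) |z. True}" by (auto elim!: dvdE)
  next
    fix z :: complex assume "z \<in> {of_int (int q * z) |z. True}"
    then obtain k where "z = of_int (int q * k)" by blast
    then show "z \<in> ?P \<inter> \<int>" by (simp only: Int_iff int_mem_qlat_iff Ints_of_int) simp
  qed
  have "coset ?P ` \<O> = (\<lambda>t. coset ?P (of_int t)) ` {0..<int q}"
  proof (intro equalityI subsetI)
    fix S assume "S \<in> coset ?P ` \<O>"
    then obtain z where z: "z \<in> \<O>" "S = coset ?P z" by blast
    then obtain t where "0 \<le> t" "t < int q" "z - of_int t \<in> ?P" using qlat_residue[OF disc q0] by blast
    then show "S \<in> (\<lambda>t. coset ?P (of_int t)) ` {0..<int q}" using z coset_eq_iff[of ?P z] by auto
  qed (use int_mem_qlat_iff[of _ 1 D] in auto)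
  moreover have "inj_on (\<lambda>t. coset ?P (of_int t)) {0..<int q}"
    by (rule inj_coset_int) (simp_all add: int_mem_qlat_iff)
  ultimately show "ideal_norm \<O> ?P = q"
    by (simp add: ideal_norm_coset card_image)
qed

text \<open>As P has norm q and meets \<int> in the multiples of q, the integers 0, ..., q - 1
  represent all cosets. So (-D + \<surd>D)/2 is congruent to some integer t, and subtracting t
  yields an element (-B + \<surd>D)/2 of P with B = D + 2 t. Its norm is an integer in P, which
  gives the equation.\<close>

lemma prime_ideal_aboveE:
  assumes q: "prime q" and P: "prime_ideal_above \<O> q P"
  obtains B k where "B * B - D = 4 * (int q * k)" "P = qlat D (int q) B"
proof -
  have prime: "primeideal P (as_ring \<O>)" and above: "P \<inter> \<int> = {of_int (int q * z) | z. True}"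
    and norm: "card (coset P ` \<O>) = q"
    using P by (auto simp: prime_ideal_above_def lies_above_def ideal_norm_coset)
  note Pd = primeidealD[OF prime]
  have int_iff: "of_int k \<in> P \<longleftrightarrow> int q dvd k" for k
  proof -
    have "of_int k \<in> P \<longleftrightarrow> (of_int k :: complex) \<in> {of_int (int q * z) | z. True}"
      unfolding above[symmetric] by simp
    also have "\<dots> \<longleftrightarrow> int q dvd k" by (auto simp only: of_int_eq_iff mem_Collect_eq dvd_def)
    finally show ?thesis .
  qed
  have "inj_on (\<lambda>t. coset P (of_int t)) {0..<int q}"
    by (rule inj_coset_int) (simp_all add: int_iff Pd)
  then have "card ((\<lambda>t. coset P (of_int t)) ` {0..<int q}) = q" by (simp add: card_image)
  moreover have "(\<lambda>t. coset P (of_int t)) ` {0..<int q} \<subseteq> coset P ` \<O>"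
    using int_mem_qlat_iff[of _ 1 D] by auto
  moreover have "finite (coset P ` \<O>)" using norm q by (metis card.infinite not_prime_0)
  ultimately have img: "(\<lambda>t. coset P (of_int t)) ` {0..<int q} = coset P ` \<O>"
    using norm by (simp add: card_subset_eq)
  have "coset P ((- of_int D + rt) / 2) \<in> coset P ` \<O>" using qlat_gens(2) by blast
  then obtain t where t: "(- of_int D + rt) / 2 - of_int t \<in> P"
    unfolding img[symmetric] using coset_eq_iff[OF Pd(2)] by auto
  define B where "B = D + 2 * t"
  have tB: "(- of_int D + rt) / 2 - of_int t = (- of_int B + rt) / 2" by (simp add: B_def field_simps)
  obtain k0 where "D * D - D = 4 * k0" using disc_sq by auto
  then have "B * B - D = 4 * (k0 + t * D + t * t)" by (simp add: B_def algebra_simps)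
  then obtain k where k: "B * B - D = 4 * k" by blast
  have "(of_int B + rt) / 2 \<in> \<O>"
    using qlat_gens(2)[of "- B" 1] order_eq_qlat[of "- B"] k by simp
  then have "((of_int B + rt) / 2) * ((- of_int B + rt) / 2) \<in> P" using Pd(3) t tB by metis
  then have "- of_int k \<in> P" using gen_norm[OF k] by (simp add: mult.commute)
  then have "int q dvd k" using add_subgrpD(3)[OF Pd(2), of "- of_int k"] int_iff by simp
  then obtain k' where k': "k = int q * k'" ..
  have disc: "B * B - D = 4 * (int q * k')" using k k' by simp
  have "qlat D (int q) B \<subseteq> P"
    unfolding qlat_eq using t tB by (intro int_span_subset[OF Pd(2)]) (simp_all only: int_iff, simp)
  moreover have "P \<subseteq> qlat D (int q) B"
  proof
    fix z assume z: "z \<in> P"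
    \<comment> \<open>Modulo the lattice z is an integer u. It lies in P, so q divides it, and it
      belongs to the lattice.\<close>
    obtain u where u: "z - of_int u \<in> qlat D (int q) B"
      using qlat_residue[OF disc] z Pd(1) q by (metis of_nat_0_less_iff prime_gt_0_nat subsetD)
    then have "z - (z - of_int u) \<in> P" using \<open>qlat D (int q) B \<subseteq> P\<close> z add_subgrpD(4)[OF Pd(2)] by blast
    then have "of_int u \<in> qlat D (int q) B" by (simp add: int_iff int_mem_qlat_iff)
    then show "z \<in> qlat D (int q) B" using add_subgrpD(2)[OF add_subgrp_qlat u] by fastforce
  qed
  ultimately show ?thesis using that disc by blast
qed

text \<open>P is larger than q \<O>, since otherwise cancelling q would give Q = \<O>. An element z
  = x + y b of P outside q \<O>, with b = (-D + \<surd>D)/2, has norm divisible by q and y prime to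
  q; dividing by y modulo q produces an element of the shape (B + \<surd>D)/2 whose norm is still
  divisible by q. The case P = Q is included, so ramified primes are covered too.\<close>

lemma split_equation_solvable:
  assumes q: "prime q" and P: "primeideal P (as_ring \<O>)" and Q: "primeideal Q (as_ring \<O>)"
    and PQ: "(*) (of_nat q) ` \<O> = lat_prod P Q"
  obtains B k where "B * B - D = 4 * (int q * k)"
proof -
  note Pd = primeidealD[OF P] and Qd = primeidealD[OF Q]
  have q0: "of_nat q \<noteq> (0 :: complex)" using q by auto
  have qO: "(*) (of_nat q) ` \<O> \<subseteq> P" using lat_prod_subset_left[OF P Qd(1)] PQ by blast
  have "\<not> P \<subseteq> (*) (of_nat q) ` \<O>"
  proof
    assume "P \<subseteq> (*) (of_nat q) ` \<O>"
    then have "P = (*) (of_nat q) ` \<O>" using qO by blast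
    then have "(*) (of_nat q) ` \<O> = (*) (of_nat q) ` lat_prod \<O> Q" using PQ lat_prod_scale by metis
    then have "\<O> = Q" using q0 scale_inj lat_prod_prime[OF Q] by metis
    then show False using Qd(4) order_one by blast
  qed
  then obtain z where z: "z \<in> P" "z \<notin> (*) (of_nat q) ` \<O>" by blast
  then have "z \<in> \<O>" using Pd(1) by blast
  then obtain x y where xy: "z = of_int x * of_int 1 + of_int y * ((- of_int D + rt) / 2)"
    unfolding mem_qlat_iff by blast
  obtain k0 where k0: "D * D - D = 4 * k0" using disc_sq by auto
  have qP: "of_int (int q * j) \<in> P" for j
  proof -
    have "of_int j \<in> \<O>" by (simp add: int_mem_qlat_iff)
    then have "of_nat q * of_int j \<in> P" using qO by blast
    then show ?thesis by simp
  qed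
  \<comment> \<open>P contains q but not 1, so an integer in P prime to q would contradict
    Bezout.\<close>
  have int_P: "int q dvd j" if "of_int j \<in> P" for j
  proof (rule ccontr)
    assume "\<not> int q dvd j"
    then have "coprime (int q) j" using q by (simp add: prime_imp_coprime)
    then obtain u v where uv: "u * int q + v * j = 1" using bezout_int by (metis coprime_imp_gcd_eq_1)
    have "of_int (int q * u) + of_int v * of_int j \<in> P"
      by (intro add_subgrpD(2)[OF Pd(2)] qP add_subgrp_of_int_mult[OF Pd(2)] that)
    then have "of_int (u * int q + v * j) \<in> P" by (simp add: mult.commute)
    then show False using uv Pd(4) by simp
  qed
  have "z * cnj z = of_int (x * x - x * y * D + y * y * k0)" by (rule order_element_norm[OF k0 xy])
  moreover have "cnj z * z \<in> P" using Pd(1,3) z cnj_mem_order by blast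
  ultimately have norm: "int q dvd x * x - x * y * D + y * y * k0"
    using int_P by (simp only: mult.commute[of "cnj z" z])
  have "\<not> int q dvd y"
  proof
    assume y: "int q dvd y"
    then have "int q dvd x * x - x * y * D + y * y * k0 + y * (x * D - y * k0)" using norm by simp
    also have "x * x - x * y * D + y * y * k0 + y * (x * D - y * k0) = x * x" by (simp add: algebra_simps)
    finally have "int q dvd x" using q prime_dvd_mult_iff[of "int q"] by simp
    then obtain x' y' where "x = int q * x'" "y = int q * y'" using y by blast
    then have "z = of_nat q * (of_int x' * of_int 1 + of_int y' * ((- of_int D + rt) / 2))"
      unfolding xy by (simp add: algebra_simps)
    moreover have "of_int x' * of_int 1 + of_int y' * ((- of_int D + rt) / 2) \<in> \<O>"
      unfolding mem_qlat_iff by blast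
    ultimately have "z \<in> (*) (of_nat q) ` \<O>" by (rule image_eqI)
    then show False using z(2) by simp
  qed
  then have "coprime (int q) y" using q by (simp add: prime_imp_coprime)
  then obtain v u where uv: "v * int q + u * y = 1" using bezout_int by (metis coprime_imp_gcd_eq_1)
  then have uy: "u * y = 1 - v * int q" by simp
  \<comment> \<open>Here (B + \<surd>D)/2 = u x + b, with b = (-D + \<surd>D)/2. As u y is 1 modulo
    q, it agrees with u z modulo q \<O>, so its norm is u^2 times that of z modulo q; the identity
    below makes this explicit through the factors u y - 1.\<close>
  define B where "B = 2 * (u * x) - D"
  have disc: "B * B - D = 4 * ((u * x) * (u * x) - (u * x) * D + k0)"
    using k0 by (simp add: B_def algebra_simps)
  have "(u * x) * (u * x) - (u * x) * D + k0 = u * u * (x * x - x * y * D + y * y * k0)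
      + u * x * D * (u * y - 1) - k0 * (u * y - 1) * (u * y + 1)"
    by (simp add: algebra_simps)
  moreover have "int q dvd u * u * (x * x - x * y * D + y * y * k0)
      + u * x * D * (u * y - 1) - k0 * (u * y - 1) * (u * y + 1)"
    using norm unfolding uy by (intro dvd_add dvd_diff) auto
  ultimately have "int q dvd (u * x) * (u * x) - (u * x) * D + k0" by (simp only:)
  then obtain k where "(u * x) * (u * x) - (u * x) * D + k0 = int q * k" ..
  then have "B * B - D = 4 * (int q * k)" using disc by simp
  then show ?thesis using that by blast
qed

text \<open>The second generators for B and -B differ by the integer B. Conversely, n dvd B gives 2
  n dvd B - (-B).\<close>

lemma qlat_eq_conj_iff:
  assumes "B * B - D = 4 * (n * k)"
  shows "qlat D n B = qlat D n (- B) \<longleftrightarrow> n dvd B"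
proof
  assume "qlat D n B = qlat D n (- B)"
  then have "(of_int B + rt) / 2 \<in> qlat D n B" using qlat_gens(2)[of "- B" n] by simp
  then have "(of_int B + rt) / 2 - (- of_int B + rt) / 2 \<in> qlat D n B"
    by (rule add_subgrpD(4)[OF add_subgrp_qlat _ qlat_gens(2)])
  then have "of_int B \<in> qlat D n B" by (simp add: field_simps)
  then show "n dvd B" by (rule int_mem_qlat)
qed (intro qlat_cong, simp)

text \<open>q \<O> is the product of the prime lattice for B and its conjugate, which are distinct
  or equal. If q ramifies, \<open>prime_factors_unique\<close> forces them to be equal, and
  \<open>qlat_eq_conj_iff\<close> applies.\<close>

lemma splits_or_ramifies:
  assumes max: "ring_of_integers K = \<O>" and q: "prime q" "\<not> q dvd g"
    and disc: "B * B - D = 4 * (int q * k)"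
  shows "rational_prime_splits K q \<or> rational_prime_ramifies K q"
    and "rational_prime_ramifies K q \<Longrightarrow> int q dvd B"
proof -
  let ?P = "qlat D (int q) B" and ?Q = "qlat D (int q) (- B)"
  have "coprime q g" using q by (intro prime_imp_coprime)
  then have "coprime (int g) (int q)" by (simp add: coprime_commute)
  then have prod: "(*) (of_nat q) ` \<O> = lat_prod ?P ?Q"
    using lat_prod_qlat_conj[OF disc gcd_disc_one[OF disc]] by simp
  have P: "primeideal ?P (as_ring \<O>)" and Q: "primeideal ?Q (as_ring \<O>)"
    using prime_ideal_above_qlat[OF q(1), of B k] prime_ideal_above_qlat[OF q(1), of "- B" k] disc
    by (auto simp: prime_ideal_above_def)
  show "rational_prime_splits K q \<or> rational_prime_ramifies K q"
    unfolding rational_prime_splits_def rational_prime_ramifies_def Let_def max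
      ideal_prod_as_ring PIdl_as_ring
    using P Q prod by (cases "?P = ?Q") (simp, blast)+
  assume "rational_prime_ramifies K q"
  then obtain L where "primeideal L (as_ring \<O>)" "(*) (of_nat q) ` \<O> = lat_prod L L"
    unfolding rational_prime_ramifies_def Let_def max ideal_prod_as_ring PIdl_as_ring by blast
  then have "?P = ?Q" using prime_factors_unique[OF P Q _ _ prod] q by auto
  then show "int q dvd B" using qlat_eq_conj_iff[OF disc] by simp
qed

lemma splits_or_ramifiesD:
  assumes max: "ring_of_integers K = \<O>" and q: "prime q"
    and "rational_prime_splits K q \<or> rational_prime_ramifies K q"
  obtains B k where "B * B - D = 4 * (int q * k)"
  using assms(3) split_equation_solvable[OF q]
  unfolding rational_prime_splits_def rational_prime_ramifies_def Let_def max ideal_prod_as_ring PIdl_as_ring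
  by blast

lemma not_splits_and_ramifies:
  assumes max: "ring_of_integers K = \<O>" and q: "prime q"
  shows "\<not> (rational_prime_splits K q \<and> rational_prime_ramifies K q)"
proof
  assume "rational_prime_splits K q \<and> rational_prime_ramifies K q"
  then obtain P Q L where PQ: "primeideal P (as_ring \<O>)" "primeideal Q (as_ring \<O>)" "P \<noteq> Q"
      "(*) (of_nat q) ` \<O> = lat_prod P Q"
    and L: "primeideal L (as_ring \<O>)" "(*) (of_nat q) ` \<O> = lat_prod L L"
    unfolding rational_prime_splits_def rational_prime_ramifies_def Let_def max ideal_prod_as_ring PIdl_as_ring
    by blast
  have "of_nat q \<noteq> (0 :: complex)" using q by auto
  then show False using prime_factors_unique[OF PQ(1,2) L(1) _ PQ(4) L(2)] PQ(3) by blast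
qed

end

section \<open>Identifying the order and the ring of integers\<close>

context quad_order
begin

text \<open>This is the characteristic polynomial of multiplication by z on the basis u, v.
  Multiplying it by u v and inserting the two rows of the matrix shows that it vanishes at
  z.\<close>

lemma order_element_quadratic:
  assumes basis: "int_basis R u v" and mult: "\<And>x y. x \<in> R \<Longrightarrow> y \<in> R \<Longrightarrow> x * y \<in> R" and z: "z \<in> R"
  obtains t n :: int where "z * z - of_int t * z + of_int n = 0"
proof -
  have R: "R = int_span u v" and indep: "\<And>x y :: int. of_int x * u + of_int y * v = 0 \<Longrightarrow> x = 0 \<and> y = 0"
    using basis by (auto simp: int_basis_def)
  have "u \<noteq> 0" using indep[of 1 0] by auto
  have "v \<noteq> 0" using indep[of 0 1] by auto
  have "z * u \<in> int_span u v" "z * v \<in> int_span u v" using mult[OF z] R by auto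
  then obtain \<alpha> \<beta> \<gamma> \<delta> :: int where zu: "z * u = of_int \<alpha> * u + of_int \<beta> * v"
    and zv: "z * v = of_int \<gamma> * u + of_int \<delta> * v"
    by (elim int_spanE)
  have "(z * z - of_int (\<alpha> + \<delta>) * z + of_int (\<alpha> * \<delta> - \<beta> * \<gamma>)) * (u * v) =
    (z * u - of_int \<alpha> * u) * (z * v - of_int \<delta> * v) - of_int \<beta> * v * (of_int \<gamma> * u)"
    by (simp add: algebra_simps)
  also have "\<dots> = 0" unfolding zu zv by (simp add: algebra_simps)
  finally have "z * z - of_int (\<alpha> + \<delta>) * z + of_int (\<alpha> * \<delta> - \<beta> * \<gamma>) = 0"
    using \<open>u \<noteq> 0\<close> \<open>v \<noteq> 0\<close> by (metis mult_eq_0_iff)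
  then show ?thesis by (rule that)
qed

text \<open>An order has a basis 1, w. With trace t and norm n of w the discriminant is t^2 - 4 n =
  D, so w is (t + \<surd>D)/2 or (t - \<surd>D)/2, and either spans with 1 the lattice
  \<open>qlat D 1 D\<close>.\<close>

lemma order_eq_of_disc:
  assumes "quadratic_order K R" and "order_has_disc R D"
  shows "R = \<O>"
proof -
  have sub: "subring R complex_ring" using assms(1) by (simp add: quadratic_order_def)
  have one: "1 \<in> R" using subringE(3)[OF sub] by simp
  have mult: "x * y \<in> R" if "x \<in> R" "y \<in> R" for x y using subringE(6)[OF sub that] by simp
  obtain u v where basis: "int_basis R u v" and disc: "(u * cnj v - cnj u * v)\<^sup>2 = of_int D"
    using assms(2) by (auto simp: order_has_disc_def)
  have R: "R = int_span u v" using basis by (simp add: int_basis_def)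
  obtain x y where xy: "1 = of_int x * u + of_int y * v" using one R by (auto elim: int_spanE)
  \<comment> \<open>If h divides both coordinates of 1, then 1/h lies in R and satisfies a monic
    integral quadratic equation; multiplying by h^2 gives h dvd 1. So 1 is a primitive vector of the
    lattice.\<close>
  define h where "h = gcd x y"
  obtain x' y' where x': "x = h * x'" "y = h * y'" unfolding h_def by (meson dvdE gcd_dvd1 gcd_dvd2)
  let ?w = "of_int x' * u + of_int y' * v"
  have hw: "of_int h * ?w = 1" using xy unfolding x' by (simp add: algebra_simps)
  have "?w \<in> R" unfolding R by (rule int_spanI) simp
  then obtain t n :: int where "?w * ?w - of_int t * ?w + of_int n = 0"
    using order_element_quadratic[OF basis mult] by blast
  then have "of_int h * of_int h * (?w * ?w - of_int t * ?w + of_int n) = 0" by simp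
  also have "of_int h * of_int h * (?w * ?w - of_int t * ?w + of_int n) =
      (of_int h * ?w) * (of_int h * ?w) - of_int (t * h) * (of_int h * ?w) + of_int (n * h * h)"
    by (simp add: algebra_simps)
  also have "\<dots> = of_int (1 - t * h + n * h * h)" unfolding hw by simp
  finally have "1 - t * h + n * h * h = 0" by (simp only: of_int_eq_0_iff)
  then have "1 = h * (t - n * h)" by (simp add: algebra_simps)
  then have "is_unit h" by (rule dvdI)
  then have "gcd x y = 1" unfolding h_def by simp
  then obtain i j where ij: "i * x + j * y = 1" using bezout_int by metis
  \<comment> \<open>The coordinates (x, y) of 1 and (-j, i) of w have determinant i x + j y =
    1.\<close>
  define w where "w = of_int i * v - of_int j * u"
  have "of_int i - of_int y * w = of_int i * 1 - of_int y * w" by simp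
  also have "\<dots> = of_int (i * x + j * y) * u"
    unfolding xy w_def by (simp add: algebra_simps)
  finally have u: "u = of_int i - of_int y * w" using ij by simp
  have "of_int j + of_int x * w = of_int j * 1 + of_int x * w" by simp
  also have "\<dots> = of_int (i * x + j * y) * v"
    unfolding xy w_def by (simp add: algebra_simps)
  finally have v: "v = of_int j + of_int x * w" using ij by simp
  have w_mem: "w \<in> R" unfolding R by (rule int_spanI[of _ "- j" _ i]) (simp add: w_def)
  have Rw: "R = int_span 1 w"
  proof
    show "R \<subseteq> int_span 1 w"
      unfolding R by (intro int_span_subset add_subgrp_int_span)
        (auto simp: u v intro: int_spanI[of _ i _ "- y"] int_spanI[of _ j _ x])
    have "add_subgrp R" by (simp add: R)
    then show "int_span 1 w \<subseteq> R" using one w_mem by (rule int_span_subset)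
  qed
  have "u * cnj v - cnj u * v = of_int (i * x + j * y) * (cnj w - w)"
    unfolding u v by (simp add: algebra_simps)
  then have w_disc: "(cnj w - w)\<^sup>2 = rt * rt" using disc ij rt_sq by simp
  have "cnj w - w \<noteq> 0" using w_disc rt_sq D_neg by auto
  obtain t n :: int where w_eq: "w * w - of_int t * w + of_int n = 0"
    using order_element_quadratic[OF basis mult w_mem] by blast
  have "cnj w * cnj w - of_int t * cnj w + of_int n = cnj (w * w - of_int t * w + of_int n)" by simp
  then have cw_eq: "cnj w * cnj w - of_int t * cnj w + of_int n = 0" using w_eq by simp
  \<comment> \<open>Subtracting the equations of w and its conjugate and removing the nonzero factor
    \<open>cnj w - w\<close> identifies t as the trace.\<close>
  have "(cnj w - w) * (cnj w + w - of_int t) =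
      (cnj w * cnj w - of_int t * cnj w + of_int n) - (w * w - of_int t * w + of_int n)"
    by (simp add: algebra_simps)
  then have "(cnj w - w) * (cnj w + w - of_int t) = 0" using w_eq cw_eq by simp
  then have "cnj w + w - of_int t = 0" using \<open>cnj w - w \<noteq> 0\<close> by (metis mult_eq_0_iff)
  then have trace: "cnj w = of_int t - w" by (simp add: algebra_simps)
  have "of_int D = (of_int t - w - w)\<^sup>2" using w_disc rt_sq trace by simp
  also have "\<dots> = of_int (t * t - 4 * n) + 4 * (w * w - of_int t * w + of_int n)"
    by (simp add: power2_eq_square algebra_simps)
  also have "\<dots> = of_int (t * t - 4 * n)" using w_eq by simp
  finally have "D = t * t - 4 * n" by (simp only: of_int_eq_iff)
  then have tn: "t * t - D = 4 * n" by simp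
  have "(of_int t - w - w)\<^sup>2 = rt\<^sup>2" using w_disc trace by (simp add: power2_eq_square)
  then have "of_int t - w - w = rt \<or> of_int t - w - w = - rt" by (simp add: power2_eq_iff)
  then show ?thesis
  proof
    assume "of_int t - w - w = - rt"
    then have w: "w = (- of_int (- t) + rt) / 2" by (simp add: field_simps)
    have "R = qlat D 1 (- t)" unfolding Rw qlat_eq w by simp
    then show ?thesis using order_eq_qlat[of "- t"] tn by simp
  next
    assume "of_int t - w - w = rt"
    then have w: "w = - ((- of_int t + rt) / 2)" by (simp add: field_simps)
    \<comment> \<open>Here w is in the lower half plane, and -w spans the same lattice with
      1.\<close>
    have sub: "int_span 1 (- z) \<subseteq> int_span 1 z" for z
      by (intro int_span_subset add_subgrpD(3)[OF add_subgrp_int_span]) simp_all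
    have "int_span 1 (- z) = int_span 1 z" for z using sub[of z] sub[of "- z"] by simp
    then have "R = qlat D 1 t" unfolding Rw qlat_eq w by simp
    then show ?thesis using order_eq_qlat[of t] tn by simp
  qed
qed

section \<open>Algebraic integers of the field\<close>

lemma algebraic_int_order:
  assumes "z \<in> \<O>" shows "algebraic_int z"
proof -
  obtain k where k: "D * D - D = 4 * k" using disc_sq by auto
  define b where "b = (- of_int D + rt) / 2"
  have b: "b * b + of_int D * b + of_int k = 0" using gen_sq[OF k] unfolding b_def[symmetric] by simp
  obtain x y where z: "z = of_int x * of_int 1 + of_int y * b"
    using assms unfolding mem_qlat_iff b_def by blast
  \<comment> \<open>The coefficients are the norm and minus the trace of x + y b.\<close>
  let ?p = "[:of_int (x * x - x * y * D + y * y * k), - of_int (2 * x - y * D), 1:]"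
  have "poly ?p z = of_int (y * y) * (b * b + of_int D * b + of_int k)"
    unfolding z by (simp add: algebra_simps)
  then have "poly ?p z = 0" using b by simp
  then show ?thesis
    by (intro algebraic_int.intros[of ?p]) (auto simp: coeff_pCons split: nat.splits)
qed

text \<open>A denominator in the order times its conjugate is its norm, a nonzero integer.\<close>

lemma K_int_denominator:
  assumes "z \<in> K" obtains h where "h \<noteq> 0" "of_int h * z \<in> \<O>"
proof -
  obtain r where r: "r \<in> \<O>" "r \<noteq> 0" "r * z \<in> \<O>" using K_denominator[OF assms] by blast
  obtain x y where xy: "r = of_int x * of_int 1 + of_int y * ((- of_int D + rt) / 2)"
    using r(1) unfolding mem_qlat_iff by blast
  obtain k where k: "D * D - D = 4 * k" using disc_sq by auto
  have norm: "cnj r * r = of_int (x * x - x * y * D + y * y * k)"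
    using order_element_norm[OF k xy] by (simp only: mult.commute)
  have "cnj r * (r * z) \<in> \<O>" using r cnj_mem_order order_mult by blast
  then have "(cnj r * r) * z \<in> \<O>" by (simp only: mult.assoc)
  then have "of_int (x * x - x * y * D + y * y * k) * z \<in> \<O>" unfolding norm .
  moreover have "cnj r * r \<noteq> 0" using r(2) by simp
  then have "x * x - x * y * D + y * y * k \<noteq> 0" unfolding norm by (simp only: of_int_eq_0_iff not_False_eq_True)
  ultimately show ?thesis by (rule that[rotated])
qed

lemma order_power: "x \<in> \<O> \<Longrightarrow> x ^ k \<in> \<O>"
  by (induction k) (auto simp: order_one intro: order_mult)

lemma order_sum: "(\<And>i. i \<in> A \<Longrightarrow> f i \<in> \<O>) \<Longrightarrow> sum f A \<in> \<O>"
  by (induction A rule: infinite_finite_induct) (auto intro: add_subgrpD[OF order_subgrp])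

lemma order_of_int: "of_int k \<in> \<O>"
  by (simp add: int_mem_qlat_iff)

text \<open>If h clears z and p is a monic integral polynomial of degree n with root z, then h^n
  clears the powers below n, and p reduces every higher power to smaller ones. A bound on
  denominators that is uniform in k passes from z to its trace and norm, which is how integrality of
  those is reached.\<close>

lemma algebraic_int_powers:
  assumes "z \<in> K" "algebraic_int z"
  obtains N :: int where "N \<noteq> 0" "\<And>k. of_int N * z ^ k \<in> \<O>"
proof -
  obtain h where h: "h \<noteq> 0" "of_int h * z \<in> \<O>" using K_int_denominator[OF assms(1)] .
  obtain p where p: "\<And>i. coeff p i \<in> \<int>" "lead_coeff p = 1" "poly p z = 0"
    using assms(2) by (metis algebraic_int.cases)
  define n where "n = degree p"
  have "(\<Sum>i\<le>n. coeff p i * z ^ i) = 0" using p(3) by (simp add: poly_altdef n_def)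
  then have zn: "z ^ n = - (\<Sum>i<n. coeff p i * z ^ i)"
    using p(2) by (simp add: lessThan_Suc_atMost[symmetric] n_def eq_neg_iff_add_eq_0 add.commute)
  have "of_int (h ^ n) * z ^ k \<in> \<O>" for k
  proof (induction k rule: less_induct)
    case (less k)
    show ?case
    proof (cases "k < n")
      case True
      then have "of_int (h ^ n) * z ^ k = of_int (h ^ (n - k)) * (of_int h * z) ^ k"
        by (simp add: power_mult_distrib mult.assoc[symmetric] power_add[symmetric])
      then show ?thesis using h(2) order_power order_mult order_of_int by metis
    next
      case False
      then have "z ^ k = z ^ (k - n) * z ^ n" by (simp add: power_add[symmetric])
      then have "of_int (h ^ n) * z ^ k = - (\<Sum>i<n. coeff p i * (of_int (h ^ n) * z ^ (k - n + i)))"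
        unfolding zn by (simp add: sum_distrib_left power_add algebra_simps)
      also have "\<dots> \<in> \<O>"
      proof (intro add_subgrpD(3)[OF order_subgrp] order_sum)
        fix i assume "i \<in> {..<n}"
        then have "of_int (h ^ n) * z ^ (k - n + i) \<in> \<O>" using False by (intro less.IH) auto
        moreover have "coeff p i \<in> \<O>" using p(1)[of i] order_of_int by (auto elim: Ints_cases)
        ultimately show "coeff p i * (of_int (h ^ n) * z ^ (k - n + i)) \<in> \<O>" by (rule order_mult[rotated])
      qed
      finally show ?thesis .
    qed
  qed
  then show ?thesis using that[of "h ^ n"] h(1) by simp
qed

lemma rat_mem_order:
  assumes "of_rat q \<in> \<O>" shows "q \<in> \<int>"
proof -
  have "(of_rat q :: complex) = of_real (of_rat q)" by (cases q) (simp add: of_rat_rat)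
  then have "of_rat q \<in> (\<int> :: real set)" using real_mem_order assms by simp
  then obtain k where "(of_rat q :: real) = of_rat (of_int k)" by (auto elim: Ints_cases)
  then show ?thesis by (simp only: of_rat_eq_iff) simp
qed

text \<open>In lowest terms a/b, every power b^k divides the fixed number N, which leaves only b =
  1.\<close>

lemma rat_int_of_powers:
  fixes r :: rat
  assumes "N \<noteq> 0" "\<And>k. of_int N * r ^ k \<in> \<int>"
  shows "r \<in> \<int>"
proof -
  obtain a b where r: "r = of_int a / of_int b" "b > 0" "coprime a b"
    by (metis Fract_of_int_quotient quotient_of_coprime quotient_of_denom_pos quotient_of_div prod.exhaust)
  have bN: "b ^ k dvd N" for k
  proof -
    obtain c where "of_int N * r ^ k = of_int c" using assms(2)[of k] by (auto elim: Ints_cases)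
    then have "(of_int (N * a ^ k) :: rat) = of_int (c * b ^ k)"
      using r by (simp add: field_simps power_divide)
    then have "N * a ^ k = c * b ^ k" by (simp only: of_int_eq_iff)
    then have "b ^ k dvd N * a ^ k" by simp
    moreover have "coprime (b ^ k) (a ^ k)" using r(3) by (simp add: coprime_commute)
    ultimately show ?thesis by (simp add: coprime_dvd_mult_left_iff)
  qed
  have "b = 1"
  proof (rule ccontr)
    assume "b \<noteq> 1"
    then have "b \<ge> 2" using r(2) by simp
    \<comment> \<open>The exponent |N| is large enough, as 2^|N| exceeds |N|.\<close>
    have "int (nat \<bar>N\<bar>) < 2 ^ nat \<bar>N\<bar>" by (metis of_nat_less_two_power)
    also have "\<dots> \<le> b ^ nat \<bar>N\<bar>" using \<open>b \<ge> 2\<close> by (intro power_mono) auto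
    also have "\<dots> \<le> \<bar>N\<bar>" using bN[of "nat \<bar>N\<bar>"] assms(1) by (intro zdvd_imp_le) simp_all
    finally show False by simp
  qed
  then show ?thesis using r by simp
qed

lemma squarefree_mult_rat_square:
  fixes y :: rat
  assumes "of_nat d * (y * y) \<in> \<int>" shows "y \<in> \<int>"
proof -
  obtain r s where y: "y = of_int r / of_int s" "s > 0" "coprime r s"
    by (metis Fract_of_int_quotient quotient_of_coprime quotient_of_denom_pos quotient_of_div prod.exhaust)
  obtain k where "of_nat d * (y * y) = of_int k" using assms by (auto elim: Ints_cases)
  then have "(of_int (int d * (r * r)) :: rat) = of_int (k * (s * s))"
    using y by (simp add: field_simps)
  then have eq: "int d * (r * r) = k * (s * s)" by (simp only: of_int_eq_iff)
  have "coprime (s\<^sup>2) (r * r)" using y(3) by (simp add: coprime_commute)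
  moreover have "s\<^sup>2 dvd int d * (r * r)" unfolding eq by (simp add: power2_eq_square)
  ultimately have "s\<^sup>2 dvd int d" by (simp add: coprime_dvd_mult_left_iff)
  then have "(nat s)\<^sup>2 dvd d" using y(2) by (metis int_dvd_int_iff int_nat_eq of_nat_power order_less_imp_le)
  then have "nat s dvd 1" using sqf unfolding squarefree_def by blast
  then have "s = 1" using y(2) by simp
  then show ?thesis using y by simp
qed

text \<open>The two cases are D = -d and D = -4 d. The bounded denominators of the powers of z and
  its conjugate give integral trace U and norm M, so z = (U + Y \<surd>(-d))/2 with U^2 + d Y^2 = 4
  M; square-freeness of d makes Y an integer, and the residues modulo 4 decide the parities of U and
  Y.\<close>

lemma ring_of_integers_eq:
  assumes "g = 1 \<and> d mod 4 = 3 \<or> g = 2 \<and> d mod 4 \<noteq> 3"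
  shows "ring_of_integers K = \<O>"
proof
  show "\<O> \<subseteq> ring_of_integers K"
    using order_subset algebraic_int_order by (auto simp: ring_of_integers_def)
  show "ring_of_integers K \<subseteq> \<O>"
  proof
    fix z assume "z \<in> ring_of_integers K"
    then have z: "z \<in> K" "algebraic_int z" by (auto simp: ring_of_integers_def)
    obtain x y :: rat where xy: "z = of_rat x + of_rat y * rt" using z(1) unfolding mem_K_iff by blast
    have cnj_rat: "cnj (of_rat q) = of_rat q" for q by (cases q) (simp add: of_rat_rat)
    have cz: "cnj z = of_rat x - of_rat y * rt" unfolding xy by (simp add: cnj_rat)
    obtain N where N: "N \<noteq> 0" "\<And>k. of_int N * z ^ k \<in> \<O>" 
      using algebraic_int_powers[OF z] by blast
    have Nc: "of_int N * cnj z ^ k \<in> \<O>" for k using cnj_mem_order[OF N(2)[of k]] by simp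
    have trace: "z + cnj z = of_rat (2 * x)" unfolding cz unfolding xy by (simp add: of_rat_mult)
    have norm: "z * cnj z = of_rat (x * x - of_int D * (y * y))"
    proof -
      have "z * cnj z = of_rat x * of_rat x - of_rat y * of_rat y * (rt * rt)"
        unfolding cz unfolding xy by (simp add: algebra_simps)
      then show ?thesis unfolding rt_sq by (simp add: of_rat_diff of_rat_mult)
    qed
    \<comment> \<open>N^2 is needed because each binomial term contains a power of z and one of its
      conjugate, each cleared by one factor N.\<close>
    have "of_int (N * N) * (2 * x) ^ k \<in> \<int>" for k
    proof (rule rat_mem_order)
      have "of_rat (of_int (N * N) * (2 * x) ^ k) = of_int (N * N) * (z + cnj z) ^ k"
        unfolding trace by (simp add: of_rat_mult of_rat_power)
      also have "\<dots> = (\<Sum>i\<le>k. of_int (int (k choose i)) * ((of_int N * z ^ i) * (of_int N * cnj z ^ (k - i))))"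
        unfolding binomial_ring sum_distrib_left by (intro sum.cong refl) (simp add: ac_simps)
      also have "\<dots> \<in> \<O>" by (intro order_sum order_mult[OF order_of_int order_mult[OF N(2) Nc]])
      finally show "of_rat (of_int (N * N) * (2 * x) ^ k) \<in> \<O>" .
    qed
    then have "2 * x \<in> \<int>" by (rule rat_int_of_powers[rotated]) (use N(1) in simp)
    moreover have "of_int (N * N) * (x * x - of_int D * (y * y)) ^ k \<in> \<int>" for k
    proof (rule rat_mem_order)
      have "of_rat (of_int (N * N) * (x * x - of_int D * (y * y)) ^ k) = of_int (N * N) * (z * cnj z) ^ k"
        unfolding norm by (simp add: of_rat_mult of_rat_power)
      also have "\<dots> = (of_int N * z ^ k) * (of_int N * cnj z ^ k)"
        by (simp add: power_mult_distrib algebra_simps)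
      also have "\<dots> \<in> \<O>" by (rule order_mult[OF N(2) Nc])
      finally show "of_rat (of_int (N * N) * (x * x - of_int D * (y * y)) ^ k) \<in> \<O>" .
    qed
    then have "x * x - of_int D * (y * y) \<in> \<int>"
      by (rule rat_int_of_powers[rotated]) (use N(1) in simp)
    ultimately obtain U M where U: "2 * x = of_int U" and N: "x * x - of_int D * (y * y) = of_int M"
      by (auto elim!: Ints_cases)
    \<comment> \<open>As \<open>rt\<close> is g \<surd>(-d), w is twice the coefficient of
      \<surd>(-d) in z, and d w^2 is four times the norm minus the squared trace.\<close>
    define w where "w = 2 * of_nat g * y"
    have "of_nat d * (w * w) = 4 * (x * x - of_int D * (y * y)) - (2 * x) * (2 * x)"
      by (simp add: D_eq w_def power2_eq_square algebra_simps)
    then have dw: "of_nat d * (w * w) = of_int (4 * M - U * U)" unfolding N U by simp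
    have "of_nat d * (w * w) \<in> \<int>" unfolding dw by (rule Ints_of_int)
    then have "w \<in> \<int>" by (rule squarefree_mult_rat_square)
    then obtain Y where Y: "w = of_int Y" by (auto elim: Ints_cases)
    have "(of_int (int d * (Y * Y)) :: rat) = of_int (4 * M - U * U)" using dw Y by simp
    then have UY: "U * U + int d * (Y * Y) = 4 * M" by (simp only: of_int_eq_iff)
    have "\<not> 4 dvd d" using sqf unfolding squarefree_def by (auto dest!: spec[of _ 2])
    have zeq: "z = of_rat (of_int U / 2) + of_rat (of_int Y / (2 * of_nat g)) * rt"
    proof -
      have "x = of_int U / 2" "y = of_int Y / (2 * of_nat g)"
        using U Y g_pos by (simp_all add: w_def field_simps)
      then show ?thesis unfolding xy by simp
    qed
    have mem: "z \<in> \<O>" if "of_int U / 2 = (of_int i - of_int j * of_int D / 2 :: rat)" 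
      "of_int Y / (2 * of_nat g) = (of_int j / 2 :: rat)" for i j
    proof -
      have "z = of_int i * of_int 1 + of_int j * ((- of_int D + rt) / 2)"
        unfolding zeq that by (simp add: of_rat_diff of_rat_mult of_rat_divide field_simps)
      then show ?thesis unfolding mem_qlat_iff by blast
    qed
    show "z \<in> \<O>"
      using assms
    proof
      assume g: "g = 1 \<and> d mod 4 = 3"
      then obtain e where d: "int d = 4 * e + 3" by (metis int_ops(3) mult_div_mod_eq of_nat_add of_nat_mult of_nat_numeral)
      \<comment> \<open>For d = 3 modulo 4 only equal parity of U and Y follows; as D is odd, this
        is what membership asks for.\<close>
      have diff: "U * U - Y * Y = 4 * (M - Y * Y - e * (Y * Y))" using UY unfolding d by (simp add: algebra_simps)
      have "even (U * U - Y * Y)" unfolding diff by simp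
      then have "even (U + Y * D)" using g d by (simp add: D_eq)
      then obtain i where "U + Y * D = 2 * i" by blast
      then have "U = 2 * i - Y * D" by simp
      then have "of_int U = (of_int (2 * i - Y * D) :: rat)" by (simp only:)
      then show ?thesis using g by (intro mem[of i Y]) (simp_all add: field_simps)
    next
      assume g: "g = 2 \<and> d mod 4 \<noteq> 3"
      \<comment> \<open>For d = 1 or 2 modulo 4, the sum U^2 + d Y^2 vanishes modulo 4 only if both
        squares do.\<close>
      have "even U \<and> even Y"
      proof -
        have sq: "a * a mod 4 = (if even a then 0 else 1)" for a :: int
        proof (cases "even a")
          case True then show ?thesis by (auto elim!: evenE)
        next
          case False
          then obtain b where "a = 2 * b + 1" by (elim oddE)
          then have "a * a = 1 + 4 * (b * b + b)" by (simp add: algebra_simps)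
          then have "a * a mod 4 = 1 mod 4" by (simp only: mod_mult_self2)
          then show ?thesis using False by simp
        qed
        have "(U * U mod 4 + (int d mod 4) * (Y * Y mod 4)) mod 4 = (U * U + int d * (Y * Y)) mod 4"
          by (intro mod_add_cong mod_mod_trivial mod_mult_eq)
        also have "\<dots> = 0" unfolding UY by simp
        finally have "(U * U mod 4 + (int d mod 4) * (Y * Y mod 4)) mod 4 = 0" .
        moreover have "d mod 4 = 1 \<or> d mod 4 = 2" using \<open>\<not> 4 dvd d\<close> g by presburger
        then have "int d mod 4 = 1 \<or> int d mod 4 = 2" by presburger
        ultimately show ?thesis unfolding sq by (auto split: if_splits)
      qed
      then obtain i j where "U = 2 * i" "Y = 2 * j" by blast
      then show ?thesis using g by (intro mem[of "i - 2 * int d * j" j]) (simp_all add: D_eq field_simps)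
    qed
  qed
qed

end

text \<open>D and D' are -d times the squares of g and g'. For odd q, both units modulo q,
  multiplication by g'/g carries a square root of D to one of D'. For q = 2 the squares of the odd
  numbers g, g' are 1 modulo 8, so D and D' agree modulo 8 and the same B serves.\<close>

lemma disc_equation_transfer:
  assumes "quad_order d g D" "quad_order d g' D'" and q: "prime q" "\<not> q dvd g" "\<not> q dvd g'"
    and eq: "B * B - D = 4 * (int q * k)"
  obtains B' k' where "B' * B' - D' = 4 * (int q * k')"
proof -
  interpret Q: quad_order d g D by fact
  interpret Q': quad_order d g' D' by fact
  show ?thesis
  proof (cases "q = 2")
    case True
    then have odd: "odd (int g)" "odd (int g')" using q by auto
    have sq: "8 dvd a\<^sup>2 - 1" if a: "odd a" for a :: int
    proof -
      obtain b where b: "a = 2 * b + 1" using a by (elim oddE)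
      have "even (b * (b + 1))" by simp
      then obtain c where "b * (b + 1) = 2 * c" by blast
      then have "a\<^sup>2 - 1 = 8 * c" by (simp add: b power2_eq_square algebra_simps)
      then show ?thesis by simp
    qed
    have "8 dvd ((int g')\<^sup>2 - 1) - ((int g)\<^sup>2 - 1)" by (intro dvd_diff sq odd)
    then obtain c where "(int g')\<^sup>2 - (int g)\<^sup>2 = 8 * c" by auto
    then have "(int g')\<^sup>2 = (int g)\<^sup>2 + 8 * c" by simp
    then have "B * B - D' = 4 * (int q * (k + c * int d))"
      using eq True by (simp add: Q.D_eq Q'.D_eq algebra_simps)
    then show ?thesis by (rule that)
  next
    case False
    have "coprime q g" using q by (intro prime_imp_coprime)
    then obtain u v where uv: "u * int q + v * int g = 1"
      using bezout_int[of "int q" "int g"] by (metis coprime_imp_gcd_eq_1 coprime_int_iff)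
    have "odd q" using False q(1) primes_dvd_imp_eq two_is_prime_nat by blast
    \<comment> \<open>By \<open>uv\<close> the number v inverts g modulo q, so B0 is B g'/g modulo
      q.\<close>
    define B0 where "B0 = B * v * int g'"
    have "B0 * B0 - D' = (int g')\<^sup>2 * (v * v * (B * B - D) + int d * (1 - (v * int g) * (v * int g)))"
      by (simp add: B0_def Q.D_eq Q'.D_eq power2_eq_square algebra_simps)
    also have "1 - (v * int g) * (v * int g) = (1 - v * int g) * (1 + v * int g)" by (simp add: algebra_simps)
    also have "1 - v * int g = u * int q" using uv by simp
    finally have B0: "int q dvd B0 * B0 - D'" unfolding eq by simp
    \<comment> \<open>Adding the odd number q corrects the parity without affecting the residue
      modulo q. Once B1 has the parity of D', divisibility by 4 follows from
      \<open>disc_cong\<close>.\<close>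
    define B1 where "B1 = (if even (B0 - D') then B0 else B0 + int q)"
    have par: "even (B1 - D')" using \<open>odd q\<close> by (simp add: B1_def)
    have "B1 * B1 - D' = B0 * B0 - D' \<or> B1 * B1 - D' = (B0 * B0 - D') + int q * (2 * B0 + int q)"
      by (simp add: B1_def algebra_simps)
    then have 1: "int q dvd B1 * B1 - D'" using B0 by (metis dvd_add dvd_triv_left)
    obtain e where e: "B1 = D' + 2 * e" using par by (metis add_diff_cancel_left' diff_add_cancel dvdE add.commute)
    obtain f where f: "D' * D' - D' = 4 * f" using Q'.disc_cong by blast
    have "B1 * B1 - D' = 4 * (f + D' * e + e * e)" using f by (simp add: e algebra_simps)
    then have 2: "4 dvd B1 * B1 - D'" by simp
    have "coprime 2 (int q)" using \<open>odd q\<close> by simp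
    then have "coprime (2 * 2) (int q)" by (simp only: coprime_mult_left_iff)
    then have "coprime 4 (int q)" by simp
    then have "4 * int q dvd B1 * B1 - D'" using divides_mult[OF 2 1] by simp
    then obtain k' where "B1 * B1 - D' = 4 * int q * k'" ..
    then have "B1 * B1 - D' = 4 * (int q * k')" by simp
    then show ?thesis by (rule that)
  qed
qed

section \<open>Splitting and ramification in terms of the discriminant\<close>

context quad_order
begin

text \<open>The discriminant of the maximal order is -d or -4 d, so g' is 1 or 2. The last property
  has content only for q = 2: if g' = 2, then g must be even.\<close>

lemma maximal_order:
  obtains g' D' where "quad_order d g' D'" "ring_of_integers K = qlat D' 1 D'"
    "\<And>q. prime q \<Longrightarrow> \<not> q dvd g \<Longrightarrow> \<not> q dvd g'"
proof -
  define g' :: nat where "g' = (if d mod 4 = 3 then 1 else 2)"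
  define D' where "D' = - ((int g')\<^sup>2 * int d)"
  have mult4: "4 dvd D' * D' - D'"
  proof (cases "d mod 4 = 3")
    case True
    then have "D' * D' - D' = int d * int (d + 1)" by (simp add: D'_def g'_def algebra_simps)
    moreover have "4 dvd d + 1" using True by presburger
    then have "4 dvd int (d + 1)" by presburger
    ultimately show ?thesis by simp
  next
    case False
    then have "D' = 4 * - int d" by (simp add: D'_def g'_def)
    then show ?thesis by (metis dvd_diff dvd_mult2 dvd_triv_left)
  qed
  have Q': "quad_order d g' D'"
    by unfold_locales (use d_pos sqf mult4 in \<open>auto simp: D'_def g'_def\<close>)
  have "ring_of_integers K = qlat D' 1 D'"
    by (rule quad_order.ring_of_integers_eq[OF Q']) (simp add: g'_def)
  moreover have "\<not> q dvd g'" if q: "prime q" "\<not> q dvd g" for q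
  proof
    assume "q dvd g'"
    then have "q = 2" "d mod 4 \<noteq> 3"
      using q(1) by (auto simp: g'_def primes_dvd_imp_eq two_is_prime_nat split: if_splits)
    then obtain e where e: "int g = 2 * e + 1" using q(2) by (metis even_of_nat oddE)
    \<comment> \<open>For odd g the square g^2 is 1 modulo 4, so D^2 - D reduces to d (d + 1), which
      4 does not divide for d = 1 or 2 modulo 4.\<close>
    have "D * D - D = int d * (int d + 1) + 4 * (int d * (e * e + e) * (2 * (int d * (e * e + e) * 2 + int d) + 1))"
      unfolding D_eq e by (simp add: power2_eq_square algebra_simps)
    then have "4 dvd int d * (int d + 1)" using disc_cong by (metis dvd_add_left_iff dvd_triv_left)
    then have "4 dvd d * (d + 1)" by (metis int_dvd_int_iff of_nat_1 of_nat_add of_nat_mult of_nat_numeral)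
    moreover have "\<not> 4 dvd d" using sqf unfolding squarefree_def by (auto dest!: spec[of _ 2])
    ultimately have "d mod 4 = 3"
    proof -
      have "d mod 4 = 1 \<or> d mod 4 = 2 \<or> d mod 4 = 3" using \<open>\<not> 4 dvd d\<close> by presburger
      moreover have "d * (d + 1) mod 4 = (d mod 4) * (d mod 4 + 1) mod 4"
        by (rule mod_mult_cong) (simp_all add: mod_simps)
      then have "(d mod 4) * (d mod 4 + 1) mod 4 = 0"
        using \<open>4 dvd d * (d + 1)\<close> by (simp only: dvd_eq_mod_eq_0)
      ultimately show ?thesis by (elim disjE) simp_all
    qed
    then show False using \<open>d mod 4 \<noteq> 3\<close> by simp
  qed
  ultimately show ?thesis using that Q' by blast
qed

text \<open>The solution is moved to the discriminant of the maximal order, where splitting and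
  ramification are defined.\<close>

lemma splits_or_ramifies_of_solution:
  assumes "prime q" "\<not> q dvd g" "B * B - D = 4 * (int q * k)"
  shows "rational_prime_splits K q \<or> rational_prime_ramifies K q"
proof -
  obtain g' D' where *: "quad_order d g' D'" "ring_of_integers K = qlat D' 1 D'"
    "\<And>q. prime q \<Longrightarrow> \<not> q dvd g \<Longrightarrow> \<not> q dvd g'" using maximal_order by blast
  obtain B' k' where "B' * B' - D' = 4 * (int q * k')"
    using disc_equation_transfer[OF quad_order_axioms *(1) assms(1,2) *(3)[OF assms(1,2)] assms(3)] .
  then show ?thesis
    using quad_order.splits_or_ramifies(1)[OF *(1,2) assms(1) *(3)[OF assms(1,2)]] by blast
qed

lemma solution_of_splits_or_ramifies:
  assumes "prime q" "\<not> q dvd g" "rational_prime_splits K q \<or> rational_prime_ramifies K q"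
  obtains B k where "B * B - D = 4 * (int q * k)"
proof -
  obtain g' D' where *: "quad_order d g' D'" "ring_of_integers K = qlat D' 1 D'"
    "\<And>q. prime q \<Longrightarrow> \<not> q dvd g \<Longrightarrow> \<not> q dvd g'" using maximal_order by blast
  obtain B' k' where "B' * B' - D' = 4 * (int q * k')"
    using quad_order.splits_or_ramifiesD[OF *(1,2) assms(1,3)] .
  from disc_equation_transfer[OF *(1) quad_order_axioms assms(1) *(3)[OF assms(1,2)] assms(2) this]
  show ?thesis using that by metis
qed

lemma splits_ramifies_exclusive:
  assumes "prime q" shows "\<not> (rational_prime_splits K q \<and> rational_prime_ramifies K q)"
proof -
  obtain g' D' where *: "quad_order d g' D'" "ring_of_integers K = qlat D' 1 D'"
    "\<And>q. prime q \<Longrightarrow> \<not> q dvd g \<Longrightarrow> \<not> q dvd g'" using maximal_order by blast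
  show ?thesis by (rule quad_order.not_splits_and_ramifies[OF *(1,2) assms])
qed

text \<open>In the maximal order q divides B', hence D'; being prime to g' it divides d, hence D and
  then B^2. It follows that B and -B give the same lattice at a ramified prime.\<close>

lemma ramifies_imp_dvd:
  assumes q: "prime q" "\<not> q dvd g" and "rational_prime_ramifies K q" and disc: "B * B - D = 4 * (int q * k)"
  shows "int q dvd B"
proof -
  obtain g' D' where *: "quad_order d g' D'" "ring_of_integers K = qlat D' 1 D'"
    "\<And>q. prime q \<Longrightarrow> \<not> q dvd g \<Longrightarrow> \<not> q dvd g'" using maximal_order by blast
  obtain B' k' where B': "B' * B' - D' = 4 * (int q * k')"
    using disc_equation_transfer[OF quad_order_axioms *(1) q *(3)[OF q] disc] .
  have "int q dvd B'"
    using quad_order.splits_or_ramifies(2)[OF *(1,2) q(1) *(3)[OF q] B' assms(3)] .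
  then have "int q dvd B' * B' - int q * (4 * k')" by simp
  also have "B' * B' - int q * (4 * k') = D'" using B' by simp
  finally have "int q dvd (int g')\<^sup>2 * int d" unfolding quad_order.D_eq[OF *(1)] by simp
  moreover have pq: "prime (int q)" using q by simp
  ultimately have "int q dvd int d"
    using *(3)[OF q] by (simp only: prime_dvd_mult_iff[OF pq] prime_dvd_power_iff[OF pq]
        int_dvd_int_iff zero_less_numeral simp_thms)
  then have "int q dvd D + int q * (4 * k)" by (simp add: D_eq)
  also have "D + int q * (4 * k) = B * B" using disc by simp
  finally show ?thesis using prime_dvd_mult_iff[OF pq] by simp
qed

section \<open>Classes of products of prime ideals\<close>

abbreviation cl :: "int \<Rightarrow> int \<Rightarrow> complex set set" where
  "cl n B \<equiv> ideal_class K \<O> (qlat D n B)"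

lemma cl_closed:
  assumes "B * B - D = 4 * (n * k)" "coprime (int g) n" "n > 0"
  shows "cl n B \<in> carrier (class_group K \<O>)"
  using assms by (intro ideal_class_closed qlat_in_ideal_group[of B n k] gcd_disc_one)

text \<open>The lattice times its conjugate is the principal ideal generated by n.\<close>

lemma cl_uminus:
  assumes disc: "B * B - D = 4 * (n * k)" and n: "coprime (int g) n" "n > 0"
  shows "inv\<^bsub>class_group K \<O>\<^esub> cl n B = cl n (- B)"
proof -
  interpret G: comm_group "class_group K \<O>" by (rule comm_group_class_group)
  have disc': "(- B) * (- B) - D = 4 * (n * k)" using disc by simp
  have in_G: "qlat D n B \<in> carrier (ideal_group K \<O>)" "qlat D n (- B) \<in> carrier (ideal_group K \<O>)"
    using qlat_in_ideal_group[OF disc] qlat_in_ideal_group[OF disc'] gcd_disc_one[OF disc]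
      gcd_disc_one[OF disc'] n by auto
  have n0: "of_int n \<in> K" "of_int n \<noteq> (0 :: complex)" using n K_of_int by auto
  have one: "\<O> \<in> carrier (ideal_group K \<O>)"
    using group.is_monoid[OF comm_group.axioms(2)[OF comm_group_ideal_group]] monoid.one_closed
    by fastforce
  have "cl n B \<otimes>\<^bsub>class_group K \<O>\<^esub> cl n (- B) = ideal_class K \<O> ((*) (of_int n) ` \<O>)"
    using ideal_class_mult[OF in_G] lat_prod_qlat_conj[OF disc gcd_disc_one[OF disc n(1)]] by simp
  also have "\<dots> = ideal_class K \<O> \<O>"
    using ideal_class_eq_iff[OF principal_in_ideal_group[OF n0] one] n0 by blast
  also have "\<dots> = \<one>\<^bsub>class_group K \<O>\<^esub>" by (rule ideal_class_one)
  finally show ?thesis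
    using in_G by (intro G.inv_equality) (auto simp: G.m_comm ideal_class_closed)
qed

lemma cl_mult:
  assumes disc: "B * B - D = 4 * (n * n' * k)" and n: "coprime (int g) n" "n > 0"
    and n': "coprime (int g) n'" "n' > 0" and "coprime n n'"
  shows "cl n B \<otimes>\<^bsub>class_group K \<O>\<^esub> cl n' B = cl (n * n') B"
proof -
  have "B * B - D = 4 * (n * (n' * k))" "B * B - D = 4 * (n' * (n * k))"
    using disc by (simp_all add: ac_simps)
  then have "qlat D n B \<in> carrier (ideal_group K \<O>)" "qlat D n' B \<in> carrier (ideal_group K \<O>)"
    using n n' by (blast intro: qlat_in_ideal_group gcd_disc_one)+
  then show ?thesis
    unfolding lat_prod_qlat[OF disc \<open>coprime n n'\<close>, symmetric] by (rule ideal_class_mult[symmetric])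
qed

lemma cl_order:
  assumes "B * B - D = 4 * k" shows "cl 1 B = \<one>\<^bsub>class_group K \<O>\<^esub>"
  using order_eq_qlat[of B] ideal_class_one assms by simp

text \<open>The moduli 2 n and 2 q are not coprime, but B and \<beta> share the parity of D. So the
  Chinese remainder theorem is applied to half of B - \<beta>, with the coprime moduli n and
  q.\<close>

lemma disc_crt:
  assumes "coprime n q" "B * B - D = 4 * (n * c)" "\<beta> * \<beta> - D = 4 * (q * k)"
  obtains B' c' where "2 * n dvd B' - B" "2 * q dvd B' - \<beta>" "B' * B' - D = 4 * (n * q * c')"
proof -
  have "even (B - D)" "even (\<beta> - D)" using disc_parity[of B] disc_parity[of \<beta>] assms(2,3) by simp_all
  then have "even ((B - D) - (\<beta> - D))" by (rule dvd_diff)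
  then have "even (B - \<beta>)" by simp
  then obtain e where e: "B - \<beta> = 2 * e" by blast
  obtain u v where uv: "u * n + v * q = 1"
    using bezout_int[of n q] assms(1) by (metis coprime_imp_gcd_eq_1)
  \<comment> \<open>As u n = 1 - v q, the correction 2 n u e is 0 modulo 2 n and 2 e = B - \<beta>
    modulo 2 q.\<close>
  define B' where "B' = B - 2 * n * (u * e)"
  have "B' - \<beta> = 2 * e * (1 - u * n)" using e by (simp add: B'_def algebra_simps)
  also have "1 - u * n = v * q" using uv by simp
  finally have B'\<beta>: "B' = \<beta> + 2 * q * (v * e)" by (simp add: algebra_simps)
  have "B' * B' - D = 4 * (n * (c - u * e * B + n * (u * e) * (u * e)))"
    using assms(2) by (simp add: B'_def algebra_simps)
  moreover have "B' * B' - D = 4 * (q * (k + v * e * \<beta> + q * (v * e) * (v * e)))"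
    using assms(3) unfolding B'\<beta> by (simp add: algebra_simps)
  ultimately have "n * (c - u * e * B + n * (u * e) * (u * e)) = q * (k + v * e * \<beta> + q * (v * e) * (v * e))"
    by simp
  then have "q dvd n * (c - u * e * B + n * (u * e) * (u * e))" by simp
  then have "q dvd c - u * e * B + n * (u * e) * (u * e)"
    using assms(1) by (simp add: coprime_dvd_mult_right_iff coprime_commute)
  then obtain c' where c': "c - u * e * B + n * (u * e) * (u * e) = q * c'" ..
  have "B' * B' - D = 4 * (n * q * c')"
    using \<open>B' * B' - D = 4 * (n * (c - u * e * B + n * (u * e) * (u * e)))\<close> unfolding c' by simp
  moreover have "2 * n dvd B' - B" by (simp add: B'_def)
  moreover have "2 * q dvd B' - \<beta>" unfolding B'\<beta> by simp
  ultimately show ?thesis by (rule that[rotated 2])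
qed

section \<open>Products over a finite set of primes\<close>

context
  fixes A :: "nat set" and p :: "nat \<Rightarrow> nat"
  assumes fin: "finite A" and primes: "\<forall>k\<in>A. prime (p k)" and inj: "inj_on p A"
    and not_dvd: "\<forall>k\<in>A. \<not> p k dvd g"
begin

lemma coprime_primes:
  assumes "F \<subseteq> A"
  shows "coprime (int g) (\<Prod>k\<in>F. int (p k))" "(\<Prod>k\<in>F. int (p k)) > 0"
    "k \<in> A \<Longrightarrow> k \<notin> F \<Longrightarrow> coprime (\<Prod>k\<in>F. int (p k)) (int (p k))"
proof -
  have "coprime g (p k)" if "k \<in> A" for k
    using primes not_dvd that by (metis coprime_commute prime_imp_coprime)
  then show "coprime (int g) (\<Prod>k\<in>F. int (p k))"
    using assms by (intro prod_coprime_right) auto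
  show "(\<Prod>k\<in>F. int (p k)) > 0"
    using assms primes by (intro prod_pos) (auto intro: prime_gt_0_nat)
  show "coprime (\<Prod>k\<in>F. int (p k)) (int (p k))" if "k \<in> A" "k \<notin> F"
  proof (rule prod_coprime_left)
    fix j assume "j \<in> F"
    then have "p j \<noteq> p k" "j \<in> A" using inj that assms by (auto simp: inj_on_def)
    then show "coprime (int (p j)) (int (p k))"
      using primes that(1) primes_coprime[of "p j" "p k"] by simp
  qed
qed

lemma coprime_prime:
  assumes "k \<in> A" shows "coprime (int g) (int (p k))" "int (p k) > 0"
  using coprime_primes(1,2)[of "{k}"] assms by simp_all

lemma finprod_cl_same:
  assumes "F \<subseteq> A" "B * B - D = 4 * ((\<Prod>k\<in>F. int (p k)) * c)"
  shows "finprod (class_group K \<O>) (\<lambda>k. cl (int (p k)) B) F = cl (\<Prod>k\<in>F. int (p k)) B"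
proof -
  interpret G: comm_group "class_group K \<O>" by (rule comm_group_class_group)
  have "finite F" using assms(1) fin by (rule finite_subset)
  then show ?thesis using assms
  proof (induction F arbitrary: c rule: finite_induct)
    case empty
    then show ?case using cl_order[of B c] by simp
  next
    case (insert j F)
    let ?n = "\<Prod>k\<in>F. int (p k)"
    have j: "j \<in> A" and F: "F \<subseteq> A" using insert.prems by auto
    have disc: "B * B - D = 4 * (int (p j) * ?n * c)" "B * B - D = 4 * (?n * (int (p j) * c))"
      using insert.prems insert.hyps by (simp_all add: ac_simps)
    have closed: "cl (int (p k)) B \<in> carrier (class_group K \<O>)" if k: "k \<in> insert j F" for k
    proof -
      have "(\<Prod>k\<in>insert j F. int (p k)) = int (p k) * (\<Prod>k\<in>insert j F - {k}. int (p k))"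
        using k insert.hyps(1) by (intro prod.remove) auto
      then have "B * B - D = 4 * (int (p k) * ((\<Prod>k\<in>insert j F - {k}. int (p k)) * c))"
        using insert.prems(2) by (simp only: mult.assoc)
      moreover have "k \<in> A" using k j F by auto
      ultimately show ?thesis using cl_closed coprime_prime by blast
    qed
    have "finprod (class_group K \<O>) (\<lambda>k. cl (int (p k)) B) (insert j F)
        = cl (int (p j)) B \<otimes>\<^bsub>class_group K \<O>\<^esub> finprod (class_group K \<O>) (\<lambda>k. cl (int (p k)) B) F"
      using insert.hyps closed by (intro G.finprod_insert) auto
    also have "\<dots> = cl (int (p j)) B \<otimes>\<^bsub>class_group K \<O>\<^esub> cl ?n B"
      using insert.IH[OF F disc(2)] by simp
    also have "\<dots> = cl (int (p j) * ?n) B"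
      using coprime_prime[OF j] coprime_primes(1,2)[OF F] coprime_primes(3)[OF F j] insert.hyps
      by (intro cl_mult[OF disc(1)]) (auto simp: coprime_commute)
    finally show ?case using insert.hyps by simp
  qed
qed

text \<open>Adding one prime at a time, \<open>disc_crt\<close> finds a single B congruent to every
  \<beta> k modulo 2 p k. Each lattice can then be rewritten with this B, as
  \<open>finprod_cl_same\<close> requires.\<close>

lemma finprod_cl:
  assumes "\<And>k. k \<in> A \<Longrightarrow> \<beta> k * \<beta> k - D = 4 * (int (p k) * c k)"
  obtains B C where "B * B - D = 4 * ((\<Prod>k\<in>A. int (p k)) * C)"
    "finprod (class_group K \<O>) (\<lambda>k. cl (int (p k)) (\<beta> k)) A = cl (\<Prod>k\<in>A. int (p k)) B"
proof -
  interpret G: comm_group "class_group K \<O>" by (rule comm_group_class_group)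
  have "\<exists>B C. B * B - D = 4 * ((\<Prod>k\<in>F. int (p k)) * C) \<and> (\<forall>k\<in>F. 2 * int (p k) dvd B - \<beta> k)"
    if "F \<subseteq> A" for F
    using finite_subset[OF that fin] that
  proof (induction F rule: finite_induct)
    case empty
    then show ?case using disc_sq by auto
  next
    case (insert j F)
    let ?n = "\<Prod>k\<in>F. int (p k)"
    have j: "j \<in> A" and F: "F \<subseteq> A" using insert.prems by auto
    obtain B C where B: "B * B - D = 4 * (?n * C)" "\<forall>k\<in>F. 2 * int (p k) dvd B - \<beta> k"
      using insert.IH[OF F] by blast
    obtain B' C' where B': "2 * ?n dvd B' - B" "2 * int (p j) dvd B' - \<beta> j"
        "B' * B' - D = 4 * (?n * int (p j) * C')"
      using disc_crt[OF coprime_primes(3)[OF F j insert.hyps(2)] B(1) assms[OF j]] .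
    have "2 * int (p k) dvd B' - \<beta> k" if k: "k \<in> F" for k
    proof -
      have "2 * int (p k) dvd 2 * ?n" using k insert.hyps(1) by (intro mult_dvd_mono dvd_prodI) auto
      then have "2 * int (p k) dvd (B' - B) + (B - \<beta> k)"
        using B'(1) B(2) k by (intro dvd_add) (auto intro: dvd_trans)
      then show ?thesis by simp
    qed
    moreover have "B' * B' - D = 4 * ((\<Prod>k\<in>insert j F. int (p k)) * C')"
      using B'(3) insert.hyps by (simp add: ac_simps)
    ultimately show ?case using B'(2) by auto
  qed
  then obtain B C where B: "B * B - D = 4 * ((\<Prod>k\<in>A. int (p k)) * C)"
    "\<forall>k\<in>A. 2 * int (p k) dvd B - \<beta> k" by blast
  have eq: "qlat D (int (p k)) (\<beta> k) = qlat D (int (p k)) B" if "k \<in> A" for k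
    using qlat_cong B(2) that by metis
  have "finprod (class_group K \<O>) (\<lambda>k. cl (int (p k)) (\<beta> k)) A = finprod (class_group K \<O>) (\<lambda>k. cl (int (p k)) B) A"
  proof (rule G.finprod_cong')
    fix k assume k: "k \<in> A"
    show "cl (int (p k)) (\<beta> k) = cl (int (p k)) B" using eq[OF k] by simp
  next
    show "(\<lambda>k. cl (int (p k)) B) \<in> A \<rightarrow> carrier (class_group K \<O>)"
    proof
      fix k assume k: "k \<in> A"
      show "cl (int (p k)) B \<in> carrier (class_group K \<O>)"
        using cl_closed[OF assms[OF k] coprime_prime[OF k]] eq[OF k] by simp
    qed
  qed simp
  then show ?thesis using that finprod_cl_same[OF subset_refl B(1)] B(1) by simp
qed

end

end

section \<open>Signs of the exponents, and the representation criterion\<close>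

lemma (in quad_order) prime_class_exponent:
  assumes disc: "\<beta> * \<beta> - D = 4 * (n * k)" "coprime (int g) n" "n > 0" and "\<delta> = 1 \<or> \<delta> = (- 1 :: int)"
  shows "cl n \<beta> [^]\<^bsub>class_group K \<O>\<^esub> \<delta> = cl n (\<delta> * \<beta>)"
proof -
  interpret G: comm_group "class_group K \<O>" by (rule comm_group_class_group)
  have closed: "cl n \<beta> \<in> carrier (class_group K \<O>)" by (rule cl_closed[OF disc])
  show ?thesis
    using assms(4)
  proof
    assume "\<delta> = 1" then show ?thesis using closed by simp
  next
    assume "\<delta> = - 1"
    then show ?thesis using G.int_pow_neg[OF closed, of 1] closed cl_uminus[OF disc] by simp
  qed
qed

text \<open>With B - \<beta> = 2 e the two equations differ by 4 e (e + \<beta>), so q divides e or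
  e + \<beta>. Halving beforehand yields the modulus 2 q, for q = 2 as well.\<close>

lemma (in quad_order) disc_solutions_agree_up_to_sign:
  assumes q: "prime q" and "B * B - D = 4 * (int q * k)" "\<beta> * \<beta> - D = 4 * (int q * c)"
  shows "2 * int q dvd B - \<beta> \<or> 2 * int q dvd B + \<beta>"
proof -
  have "even (B - D)" "even (\<beta> - D)" using disc_parity[of B] disc_parity[of \<beta>] assms(2,3) by simp_all
  then have "even ((B - D) - (\<beta> - D))" by (rule dvd_diff)
  then have "even (B - \<beta>)" by simp
  then obtain e where e: "B - \<beta> = 2 * e" by blast
  then have B: "B = \<beta> + 2 * e" by simp
  have "4 * (e * (e + \<beta>)) = (B * B - D) - (\<beta> * \<beta> - D)" unfolding B by (simp add: algebra_simps)
  also have "\<dots> = 4 * (int q * (k - c))" unfolding assms(2,3) by (simp add: algebra_simps)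
  finally have "e * (e + \<beta>) = int q * (k - c)" by simp
  then have "int q dvd e * (e + \<beta>)" by simp
  then have "int q dvd e \<or> int q dvd e + \<beta>" using q prime_dvd_mult_iff[of "int q"] by simp
  moreover have "B + \<beta> = 2 * (e + \<beta>)" unfolding B by simp
  ultimately show ?thesis using e by (metis mult_dvd_mono dvd_refl)
qed

text \<open>The equivalence is asserted for every choice \<open>\<pp>\<close> of primes, and the
  first conjunct shows that a choice exists. \<open>\<pp>\<close> is constrained only where p k
  splits or ramifies, so that an m with an inert prime factor is covered too.\<close>

theorem theorem5p2:
  fixes s m d f_K :: nat and p :: "nat \<Rightarrow> nat" and a b c D :: int
    and K \<O> :: "complex set"
  assumes "\<forall>k\<in>{1..s}. prime (p k)" and "inj_on p {1..s}"
    and "m = (\<Prod>k\<in>{1..s}. p k)"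
    and "bqf_primitive (a, b, c)" and "bqf_pos_def (a, b, c)"
    and "D = b^2 - 4 * a * c"
    and "D = - ((int f_K)^2 * int d)"
    and "d > 0" and "squarefree d" and "f_K > 0" and "coprime f_K m"
    and "K = imag_quad_field d"
    and "quadratic_order K \<O>" and "order_has_disc \<O> D"
  shows "(\<forall>k\<in>{1..s}. rational_prime_splits K (p k) \<or> rational_prime_ramifies K (p k) \<longrightarrow>
            (\<exists>P. prime_ideal_above \<O> (p k) P)) \<and>
         (\<forall>\<pp> :: nat \<Rightarrow> complex set.
            (\<forall>k\<in>{1..s}. rational_prime_splits K (p k) \<or> rational_prime_ramifies K (p k) \<longrightarrow>
               prime_ideal_above \<O> (p k) (\<pp> k)) \<longrightarrow>
            ((\<exists>x y :: int. a * x^2 + b * x * y + c * y^2 = int m) \<longleftrightarrow>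
             (\<forall>k\<in>{1..s}. rational_prime_splits K (p k) \<or> rational_prime_ramifies K (p k)) \<and>
             (\<exists>\<delta> :: nat \<Rightarrow> int.
                (\<forall>i\<in>{k\<in>{1..s}. rational_prime_splits K (p k)}. \<delta> i \<in> {-1, 1}) \<and>
                (\<Otimes>\<^bsub>class_group K \<O>\<^esub>i\<in>{k\<in>{1..s}. rational_prime_splits K (p k)}.
                   ideal_class K \<O> (\<pp> i) [^]\<^bsub>class_group K \<O>\<^esub> \<delta> i)
                \<otimes>\<^bsub>class_group K \<O>\<^esub>
                (\<Otimes>\<^bsub>class_group K \<O>\<^esub>j\<in>{k\<in>{1..s}. rational_prime_ramifies K (p k)}.
                   ideal_class K \<O> (\<pp> j))
                = ideal_class_of_bqf_class K \<O> (bqf_class (a, b, c)))))"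
proof -
  have "4 dvd D * D - D"
  proof -
    \<comment> \<open>D is b^2 modulo 4, and a square is 0 or 1 modulo 4.\<close>
    have "D * D - D = b * b * (b * b - 1) + 4 * (a * c * (4 * (a * c) - 2 * (b * b) + 1))"
      unfolding assms(6) by (simp add: power2_eq_square algebra_simps)
    moreover have "4 dvd b * b * (b * b - 1)"
    proof (cases "even b")
      case False
      then obtain e where "b = 2 * e + 1" by (elim oddE)
      then have "b * b - 1 = 4 * (e * e + e)" by (simp add: algebra_simps)
      then show ?thesis by simp
    qed (auto elim!: evenE)
    ultimately show ?thesis by simp
  qed
  then interpret Q: quad_order d f_K D
    using assms by unfold_locales auto
  note K = \<open>K = imag_quad_field d\<close>
  have O: "\<O> = qlat D 1 D" using assms(12-14) by (metis Q.order_eq_of_disc)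
  let ?A = "{1..s}"
  let ?S = "{k\<in>?A. rational_prime_splits K (p k)}" and ?R = "{k\<in>?A. rational_prime_ramifies K (p k)}"
  let ?G = "class_group K \<O>"
  interpret G: comm_group ?G using Q.comm_group_class_group unfolding K O .
  have primes: "prime (p k)" if "k \<in> ?A" for k using assms(1) that by blast
  have not_dvd: "\<not> p k dvd f_K" if k: "k \<in> ?A" for k
  proof
    assume "p k dvd f_K"
    moreover have "p k dvd m" unfolding assms(3) using k by (intro dvd_prodI) auto
    ultimately have "p k dvd 1" using assms(11) by (meson coprime_common_divisor)
    then show False using primes[OF k] by simp
  qed
  have "\<forall>k\<in>?A. \<not> p k dvd f_K" using not_dvd by blast
  note prime_facts = finite_atLeastAtMost[of 1 s] assms(1,2) this
  note coprime_p = Q.coprime_prime[OF prime_facts]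
  have m: "int m = (\<Prod>k\<in>?A. int (p k))" using assms(3) by simp
  have m_pos: "int m > 0" and m_coprime: "coprime (int f_K) (int m)"
    using Q.coprime_primes(1,2)[OF prime_facts subset_refl] unfolding m by blast+
  have m_sqf: "squarefree (int m)"
    unfolding m
  proof (rule squarefree_prod_coprime)
    show "coprime (int (p i)) (int (p j))" if ij: "i \<in> ?A" "j \<in> ?A" "i \<noteq> j" for i j
    proof -
      have "p i \<noteq> p j" using ij inj_onD[OF assms(2)] by blast
      then have "coprime (p i) (p j)" by (rule primes_coprime[OF primes[OF ij(1)] primes[OF ij(2)]])
      then show ?thesis by simp
    qed
    show "squarefree (int (p i))" if "i \<in> ?A" for i
      using primes[OF that] by (intro squarefree_prime) simp
  qed
  have f: "(a, b, c) \<in> bqf_forms D" using assms(4-6) by (simp add: bqf_forms_def)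
  have a_pos: "a > 0"
  proof -
    have "\<forall>x y. (x, y) \<noteq> (0, 0) \<longrightarrow> bqf_eval (a, b, c) x y > 0"
      using assms(5) unfolding bqf_pos_def_def .
    then have "bqf_eval (a, b, c) 1 0 > 0" by (metis prod.inject one_neq_zero)
    then show ?thesis by simp
  qed
  have disc: "b * b - D = 4 * (a * c)" using assms(6) by (simp add: power2_eq_square)
  have prim: "gcd a (gcd b c) = 1" using assms(4) by simp
  have class_f: "ideal_class_of_bqf_class K \<O> (bqf_class (a, b, c)) = Q.cl a b"
    using Q.ideal_class_of_bqf_class_eq[OF f] unfolding K O .
  have sign_sq: "(\<epsilon> * x) * (\<epsilon> * x) = x * x" if "\<epsilon> = 1 \<or> \<epsilon> = - 1" for \<epsilon> x :: int
    using that by auto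
  have product_class: "\<exists>B C. B * B - D = 4 * (int m * C) \<and>
      (\<Otimes>\<^bsub>?G\<^esub>k\<in>?A. Q.cl (int (p k)) (\<gamma> k)) = Q.cl (int m) B"
    if \<gamma>: "\<forall>k\<in>?A. \<gamma> k * \<gamma> k - D = 4 * (int (p k) * j k)" for \<gamma> j
    unfolding m K O
  proof (rule Q.finprod_cl[OF prime_facts])
    show "\<gamma> k * \<gamma> k - D = 4 * (int (p k) * j k)" if "k \<in> ?A" for k using \<gamma> that by blast
  qed blast
  have part1: "\<exists>P. prime_ideal_above \<O> (p k) P"
    if k: "k \<in> ?A" "rational_prime_splits K (p k) \<or> rational_prime_ramifies K (p k)" for k
  proof -
    obtain B j where "B * B - D = 4 * (int (p k) * j)"
      using Q.solution_of_splits_or_ramifies[OF primes[OF k(1)] not_dvd[OF k(1)]] k(2) unfolding K by blast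
    then show ?thesis using Q.prime_ideal_above_qlat[OF primes[OF k(1)]] unfolding O by blast
  qed
  have part2: "(\<exists>x y :: int. a * x^2 + b * x * y + c * y^2 = int m) \<longleftrightarrow>
             (\<forall>k\<in>?A. rational_prime_splits K (p k) \<or> rational_prime_ramifies K (p k)) \<and>
             (\<exists>\<delta> :: nat \<Rightarrow> int. (\<forall>i\<in>?S. \<delta> i \<in> {-1, 1}) \<and>
                (\<Otimes>\<^bsub>?G\<^esub>i\<in>?S. ideal_class K \<O> (\<pp> i) [^]\<^bsub>?G\<^esub> \<delta> i) \<otimes>\<^bsub>?G\<^esub>
                (\<Otimes>\<^bsub>?G\<^esub>j\<in>?R. ideal_class K \<O> (\<pp> j)) = Q.cl a b)" (is "?L \<longleftrightarrow> ?split \<and> ?rhs")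
    if above: "\<forall>k\<in>?A. rational_prime_splits K (p k) \<or> rational_prime_ramifies K (p k) \<longrightarrow>
               prime_ideal_above \<O> (p k) (\<pp> k)" for \<pp>
  proof -
    \<comment> \<open>The two products are merged into one over all indices, with sign \<delta> k at
      split and 1 at ramified primes. One \<beta> has to serve for all \<delta>, since for the
      forward direction \<delta> is chosen in terms of \<beta>.\<close>
    have product: "\<exists>\<beta> j. (\<forall>k\<in>?A. \<beta> k * \<beta> k - D = 4 * (int (p k) * j k)) \<and>
        (\<forall>\<delta>. (\<forall>i\<in>?S. \<delta> i \<in> {-1, 1}) \<longrightarrow>
          (\<Otimes>\<^bsub>?G\<^esub>i\<in>?S. ideal_class K \<O> (\<pp> i) [^]\<^bsub>?G\<^esub> \<delta> i) \<otimes>\<^bsub>?G\<^esub>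
          (\<Otimes>\<^bsub>?G\<^esub>j\<in>?R. ideal_class K \<O> (\<pp> j)) =
          (\<Otimes>\<^bsub>?G\<^esub>k\<in>?A. Q.cl (int (p k)) ((if k \<in> ?S then \<delta> k else 1) * \<beta> k)))"
      if all: ?split
    proof -
      have "\<forall>k\<in>?A. \<exists>B j. B * B - D = 4 * (int (p k) * j) \<and> \<pp> k = qlat D (int (p k)) B"
        using Q.prime_ideal_aboveE[OF primes] above all unfolding O by metis
      then obtain \<beta> j where \<beta>: "\<And>k. k \<in> ?A \<Longrightarrow> \<beta> k * \<beta> k - D = 4 * (int (p k) * j k)"
        "\<And>k. k \<in> ?A \<Longrightarrow> \<pp> k = qlat D (int (p k)) (\<beta> k)"
        by metis
      have "(\<Otimes>\<^bsub>?G\<^esub>i\<in>?S. ideal_class K \<O> (\<pp> i) [^]\<^bsub>?G\<^esub> \<delta> i) \<otimes>\<^bsub>?G\<^esub>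
          (\<Otimes>\<^bsub>?G\<^esub>j\<in>?R. ideal_class K \<O> (\<pp> j)) =
          (\<Otimes>\<^bsub>?G\<^esub>k\<in>?A. Q.cl (int (p k)) ((if k \<in> ?S then \<delta> k else 1) * \<beta> k))"
        if \<delta>: "\<forall>i\<in>?S. \<delta> i \<in> {-1, 1}" for \<delta>
      proof -
        let ?\<epsilon> = "\<lambda>k. if k \<in> ?S then \<delta> k else 1"
        have \<epsilon>: "?\<epsilon> k = 1 \<or> ?\<epsilon> k = - 1" if "k \<in> ?A" for k using \<delta> that by auto
        have closed: "Q.cl (int (p k)) (?\<epsilon> k * \<beta> k) \<in> carrier ?G" if k: "k \<in> ?A" for k
        proof -
          have "(?\<epsilon> k * \<beta> k) * (?\<epsilon> k * \<beta> k) - D = 4 * (int (p k) * j k)"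
            unfolding sign_sq[OF \<epsilon>[OF k]] by (rule \<beta>(1)[OF k])
          then show ?thesis using Q.cl_closed coprime_p[OF k] unfolding K O by blast
        qed
        have closed_on: "(\<lambda>k. Q.cl (int (p k)) (?\<epsilon> k * \<beta> k)) \<in> F \<rightarrow> carrier ?G" if "F \<subseteq> ?A" for F
          using closed that by blast
        have disj: "?S \<inter> ?R = {}"
          using Q.splits_ramifies_exclusive primes unfolding K by blast
        have union: "?A = ?S \<union> ?R" using all by blast
        have S: "(\<Otimes>\<^bsub>?G\<^esub>i\<in>?S. ideal_class K \<O> (\<pp> i) [^]\<^bsub>?G\<^esub> \<delta> i) = (\<Otimes>\<^bsub>?G\<^esub>k\<in>?S. Q.cl (int (p k)) (?\<epsilon> k * \<beta> k))"
        proof (rule G.finprod_cong')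
          fix k assume k: "k \<in> ?S"
          then have kA: "k \<in> ?A" by simp
          have "\<delta> k = 1 \<or> \<delta> k = - 1" using \<delta> k by auto
          from Q.prime_class_exponent[OF \<beta>(1)[OF kA] coprime_p[OF kA] this]
          show "ideal_class K \<O> (\<pp> k) [^]\<^bsub>?G\<^esub> \<delta> k = Q.cl (int (p k)) (?\<epsilon> k * \<beta> k)"
            unfolding \<beta>(2)[OF kA] K O using k unfolding K by simp
        qed (rule refl, rule closed_on, blast)
        have R: "(\<Otimes>\<^bsub>?G\<^esub>j\<in>?R. ideal_class K \<O> (\<pp> j)) = (\<Otimes>\<^bsub>?G\<^esub>k\<in>?R. Q.cl (int (p k)) (?\<epsilon> k * \<beta> k))"
        proof (rule G.finprod_cong')
          fix k assume k: "k \<in> ?R"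
          then have "k \<in> ?A" "k \<notin> ?S" using disj by auto
          then show "ideal_class K \<O> (\<pp> k) = Q.cl (int (p k)) (?\<epsilon> k * \<beta> k)"
            using \<beta>(2)[of k] unfolding K O by simp
        qed (rule refl, rule closed_on, blast)
        have "(\<Otimes>\<^bsub>?G\<^esub>k\<in>?S \<union> ?R. Q.cl (int (p k)) (?\<epsilon> k * \<beta> k)) =
            (\<Otimes>\<^bsub>?G\<^esub>k\<in>?S. Q.cl (int (p k)) (?\<epsilon> k * \<beta> k)) \<otimes>\<^bsub>?G\<^esub>
            (\<Otimes>\<^bsub>?G\<^esub>k\<in>?R. Q.cl (int (p k)) (?\<epsilon> k * \<beta> k))"
        proof (rule G.finprod_Un_disjoint)
          show "finite ?S" "finite ?R" by simp_all
        qed (rule disj, (rule closed_on, blast)+)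
        then show ?thesis unfolding S R union[symmetric] by (rule sym)
      qed
      then show ?thesis using \<beta>(1) by blast
    qed
    show ?thesis
    proof
      assume ?L
      then obtain x y where "a * x^2 + b * x * y + c * y^2 = int m" by blast
      then obtain B C where B: "B * B - D = 4 * (int m * C)" and class_B: "Q.cl a b = Q.cl (int m) B"
        using Q.represented_qlat_class[OF disc prim a_pos m_sqf m_pos m_coprime] by blast
      have Bk: "\<exists>j. B * B - D = 4 * (int (p k) * j)" if k: "k \<in> ?A" for k
      proof -
        have "int (p k) dvd int m" unfolding m using k by (intro dvd_prodI) auto
        then show ?thesis using B by (metis dvdE mult.assoc)
      qed
      have all: ?split
        using Q.splits_or_ramifies_of_solution[OF primes not_dvd] Bk unfolding K by blast
      obtain \<beta> j where \<beta>: "\<forall>k\<in>?A. \<beta> k * \<beta> k - D = 4 * (int (p k) * j k)"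
        and prod: "\<And>\<delta>. (\<forall>i\<in>?S. \<delta> i \<in> {-1, 1}) \<Longrightarrow>
          (\<Otimes>\<^bsub>?G\<^esub>i\<in>?S. ideal_class K \<O> (\<pp> i) [^]\<^bsub>?G\<^esub> \<delta> i) \<otimes>\<^bsub>?G\<^esub>
          (\<Otimes>\<^bsub>?G\<^esub>j\<in>?R. ideal_class K \<O> (\<pp> j)) =
          (\<Otimes>\<^bsub>?G\<^esub>k\<in>?A. Q.cl (int (p k)) ((if k \<in> ?S then \<delta> k else 1) * \<beta> k))"
        using product[OF all] by blast
      \<comment> \<open>At a split prime the sign is chosen so that \<delta> k * \<beta> k is B
        modulo 2 p k.\<close>
      define \<delta> :: "nat \<Rightarrow> int" where "\<delta> k = (if 2 * int (p k) dvd B - \<beta> k then 1 else - 1)" for k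
      have same: "Q.cl (int (p k)) ((if k \<in> ?S then \<delta> k else 1) * \<beta> k) = Q.cl (int (p k)) B"
        if k: "k \<in> ?A" for k
      proof -
        have dis: "2 * int (p k) dvd B - \<beta> k \<or> 2 * int (p k) dvd B + \<beta> k"
          using Q.disc_solutions_agree_up_to_sign[OF primes[OF k]] Bk[OF k] \<beta> k by blast
        have "2 * int (p k) dvd B - (if k \<in> ?S then \<delta> k else 1) * \<beta> k"
        proof (cases "k \<in> ?S")
          case True
          then show ?thesis using dis by (auto simp: \<delta>_def)
        next
          case False
          then have "rational_prime_ramifies K (p k)" using all k by blast
          \<comment> \<open>At a ramified prime the sign 1 is right even if B is -\<beta> k, as the
            two differ by a multiple of 2 p k.\<close>
          then have "int (p k) dvd \<beta> k"
            using Q.ramifies_imp_dvd[OF primes[OF k] not_dvd[OF k]] \<beta> k unfolding K by blast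
          then have "2 * int (p k) dvd 2 * \<beta> k" by simp
          then have "2 * int (p k) dvd B + \<beta> k \<Longrightarrow> 2 * int (p k) dvd (B + \<beta> k) - 2 * \<beta> k"
            by (intro dvd_diff)
          then show ?thesis using dis False by auto
        qed
        then have "qlat D (int (p k)) B = qlat D (int (p k)) ((if k \<in> ?S then \<delta> k else 1) * \<beta> k)"
          by (rule Q.qlat_cong)
        then show ?thesis by simp
      qed
      have \<delta>: "\<forall>i\<in>?S. \<delta> i \<in> {-1, 1}" by (simp add: \<delta>_def)
      have "(\<Otimes>\<^bsub>?G\<^esub>k\<in>?A. Q.cl (int (p k)) ((if k \<in> ?S then \<delta> k else 1) * \<beta> k)) = (\<Otimes>\<^bsub>?G\<^esub>k\<in>?A. Q.cl (int (p k)) B)"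
      proof (rule G.finprod_cong')
        have "Q.cl (int (p k)) B \<in> carrier ?G" if k: "k \<in> ?A" for k
          using Q.cl_closed[OF _ coprime_p[OF k]] Bk[OF k] unfolding K O by blast
        then show "(\<lambda>k. Q.cl (int (p k)) B) \<in> ?A \<rightarrow> carrier ?G" by blast
      qed (use same in auto)
      also have "\<dots> = Q.cl (int m) B"
        using Q.finprod_cl_same[OF prime_facts subset_refl, of B C] B unfolding m K O by blast
      finally have "(\<Otimes>\<^bsub>?G\<^esub>i\<in>?S. ideal_class K \<O> (\<pp> i) [^]\<^bsub>?G\<^esub> \<delta> i) \<otimes>\<^bsub>?G\<^esub>
          (\<Otimes>\<^bsub>?G\<^esub>j\<in>?R. ideal_class K \<O> (\<pp> j)) = Q.cl a b"
        using prod[OF \<delta>] class_B by simp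
      then show "?split \<and> ?rhs" using all \<delta> by blast
    next
      assume "?split \<and> ?rhs"
      then obtain \<delta> where all: ?split and \<delta>: "\<forall>i\<in>?S. \<delta> i \<in> {-1, 1 :: int}" 
        and eq: "(\<Otimes>\<^bsub>?G\<^esub>i\<in>?S. ideal_class K \<O> (\<pp> i) [^]\<^bsub>?G\<^esub> \<delta> i) \<otimes>\<^bsub>?G\<^esub>
          (\<Otimes>\<^bsub>?G\<^esub>j\<in>?R. ideal_class K \<O> (\<pp> j)) = Q.cl a b" by blast
      let ?\<epsilon> = "\<lambda>k. if k \<in> ?S then \<delta> k else 1"
      obtain \<beta> j where \<beta>: "\<forall>k\<in>?A. \<beta> k * \<beta> k - D = 4 * (int (p k) * j k)"
        and prod_all: "\<And>\<delta>. (\<forall>i\<in>?S. \<delta> i \<in> {-1, 1}) \<Longrightarrow>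
          (\<Otimes>\<^bsub>?G\<^esub>i\<in>?S. ideal_class K \<O> (\<pp> i) [^]\<^bsub>?G\<^esub> \<delta> i) \<otimes>\<^bsub>?G\<^esub>
          (\<Otimes>\<^bsub>?G\<^esub>j\<in>?R. ideal_class K \<O> (\<pp> j)) =
          (\<Otimes>\<^bsub>?G\<^esub>k\<in>?A. Q.cl (int (p k)) ((if k \<in> ?S then \<delta> k else 1) * \<beta> k))"
        using product[OF all] by blast
      note prod = trans[OF prod_all[OF \<delta>, symmetric] eq]
      have "(?\<epsilon> k * \<beta> k) * (?\<epsilon> k * \<beta> k) - D = 4 * (int (p k) * j k)" if k: "k \<in> ?A" for k
      proof -
        have \<epsilon>: "?\<epsilon> k = 1 \<or> ?\<epsilon> k = - 1" using \<delta> k by auto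
        show ?thesis unfolding sign_sq[OF \<epsilon>] using \<beta> k by blast
      qed
      \<comment> \<open>The signs do not affect the squares, so the signed \<beta> k are again
        admissible input for the Chinese remainder step in \<open>product_class\<close>.\<close>
      then have "\<forall>k\<in>?A. (?\<epsilon> k * \<beta> k) * (?\<epsilon> k * \<beta> k) - D = 4 * (int (p k) * j k)" by (rule ballI)
      from product_class[OF this] obtain B C where B: "B * B - D = 4 * (int m * C)"
        and class_B: "Q.cl a b = Q.cl (int m) B"
        unfolding prod by blast
      obtain z where "z \<noteq> 0" "qlat D a b = (*) z ` qlat D (int m) B"
        using Q.ideal_class_eq_iff[OF Q.qlat_in_ideal_group[OF disc prim a_pos]
            Q.qlat_in_ideal_group[OF B Q.gcd_disc_one[OF B m_coprime] m_pos]] class_B by blast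
      then show ?L
        using Q.represents_of_scaled[OF disc prim a_pos B Q.gcd_disc_one[OF B m_coprime] m_pos] by blast
    qed
  qed
  show ?thesis unfolding class_f using part1 part2 by blast
qed

end
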